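(* Let $(B^n,g_B)$ and $(F^m,g_F)$ be semi-Riemannian manifolds, let $f:B\to\mathbb{R}$ be a smooth positive function, and let $M=B^n\times_f F^m$ be the warped product with metric $\widetilde g=g_B+f^2g_F$. Suppose that $(M,\widetilde g)$ is a gradient Ricci soliton with potential function $h:M\to\mathbb{R}$, i.e. $\mathrm{Ric}_{\widetilde g}+\mathrm{Hess}_{\widetilde g}(h)=\rho\,\widetilde g$ for some $\rho\in\mathbb{R}$, and that there is at least one pair of vectors $(X_i,X_k)$ tangent to the base (at some common point of $B$) such that $\mathrm{Hess}_{g_B}(f)(X_i,X_k)\neq 0$. Then $h$ depends only on the base, i.e. $h(p,q)=h(p,q')$ for all $p\in B$ and $q,q'\in F$.
   Context: A semi-Riemannian manifold $(M,g)$ of dimension at least $3$ is a gradient Ricci soliton if there exist a smooth function $h:M\to\mathbb{R}$ (the potential function) and a constant $\rho\in\mathbb{R}$ with $\mathrm{Ric}_g+\mathrm{Hess}_g(h)=\rho g$; completeness is not required. For semi-Riemannian manifolds $(B,g_B)$ (base), $(F,g_F)$ (fiber) and a smooth function $f>0$ on $B$ (warping function), the warped product $B\times_fF$ is the product manifold $B\times F$ with metric $\widetilde g=g_B+f^2g_F$ (pullbacks along the projections understood). Manifolds are smooth and connected. *)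

theory Defs
  imports "HOL-Analysis.Analysis"
begin

section \<open>Smooth maps on open subsets of Euclidean spaces\<close>

abbreviation ddir ::
  "('e::real_normed_vector \<Rightarrow> 'x::real_normed_vector) \<Rightarrow> 'e \<Rightarrow> 'e \<Rightarrow> 'x"
  where "ddir u v x \<equiv> frechet_derivative u (at x) v"

text \<open>Only used for open \<open>S\<close> in finite dimension, where it is the usual notion of class \<open>C\<^sup>k\<close>.\<close>

primrec Ck_on ::
  "nat \<Rightarrow> 'e::real_normed_vector set \<Rightarrow> ('e \<Rightarrow> 'x::real_normed_vector) \<Rightarrow> bool"
where
  "Ck_on 0 S u \<longleftrightarrow> continuous_on S u"
| "Ck_on (Suc k) S u \<longleftrightarrow> (\<forall>x\<in>S. u differentiable (at x)) \<and> (\<forall>v. Ck_on k S (ddir u v))"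

definition Cinf_on ::
  "'e::real_normed_vector set \<Rightarrow> ('e \<Rightarrow> 'x::real_normed_vector) \<Rightarrow> bool"
  where "Cinf_on S u \<longleftrightarrow> (\<forall>k. Ck_on k S u)"


section \<open>Smooth manifolds\<close>

text \<open>A chart is a pair of its domain and the coordinate map; the coordinate map has no
  meaning outside the domain. The dimension of the manifold is \<open>DIM('e)\<close>.\<close>

type_synonym ('a, 'e) chart = "'a set \<times> ('a \<Rightarrow> 'e)"

abbreviation chart_dom :: "('a, 'e) chart \<Rightarrow> 'a set"
  where "chart_dom \<equiv> fst"

abbreviation chart_img :: "('a, 'e) chart \<Rightarrow> 'e set"
  where "chart_img C \<equiv> snd C ` fst C"

abbreviation chart_inv :: "('a, 'e) chart \<Rightarrow> 'e \<Rightarrow> 'a"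
  where "chart_inv C \<equiv> inv_into (fst C) (snd C)"

record ('a, 'e) mfd =
  mtop :: "'a topology"
  atlas :: "('a, 'e) chart set"

abbreviation points :: "('a, 'e) mfd \<Rightarrow> 'a set"
  where "points M \<equiv> topspace (mtop M)"

text \<open>The atlas need not be maximal; its charts already determine the smooth functions.\<close>

definition smooth_manifold :: "('a, 'e::euclidean_space) mfd \<Rightarrow> bool" where
  "smooth_manifold M \<longleftrightarrow>
     Hausdorff_space (mtop M) \<and> second_countable (mtop M) \<and>
     connected_space (mtop M) \<and> points M \<noteq> {} \<and>
     \<Union> (chart_dom ` atlas M) = points M \<and>
     (\<forall>C\<in>atlas M. openin (mtop M) (chart_dom C) \<and> open (chart_img C) \<and>
        homeomorphic_map (subtopology (mtop M) (chart_dom C)) (top_of_set (chart_img C)) (snd C)) \<and>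
     (\<forall>C\<in>atlas M. \<forall>D\<in>atlas M.
        Cinf_on (snd C ` (chart_dom C \<inter> chart_dom D)) (snd D \<circ> chart_inv C))"

definition smooth_fun_on ::
  "('a, 'e::euclidean_space) mfd \<Rightarrow> 'a set \<Rightarrow> ('a \<Rightarrow> real) \<Rightarrow> bool"
where
  "smooth_fun_on M W u \<longleftrightarrow>
     (\<forall>C\<in>atlas M. Cinf_on (snd C ` (chart_dom C \<inter> W)) (u \<circ> chart_inv C))"

definition smooth_near ::
  "('a, 'e::euclidean_space) mfd \<Rightarrow> 'a \<Rightarrow> ('a \<Rightarrow> real) \<Rightarrow> bool"
where
  "smooth_near M p u \<longleftrightarrow> (\<exists>W. openin (mtop M) W \<and> p \<in> W \<and> smooth_fun_on M W u)"

definition prod_mfd :: "('a, 'e) mfd \<Rightarrow> ('b, 'f) mfd \<Rightarrow> ('a \<times> 'b, 'e \<times> 'f) mfd" where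
  "prod_mfd M N =
     \<lparr>mtop = prod_topology (mtop M) (mtop N),
      atlas = {(chart_dom C \<times> chart_dom D, map_prod (snd C) (snd D)) | C D.
                 C \<in> atlas M \<and> D \<in> atlas N}\<rparr>"


section \<open>Tangent vectors\<close>

text \<open>Tangent vectors at \<open>p\<close> are derivations on the real functions that are smooth near \<open>p\<close>,
  extended by \<open>0\<close> to all other functions. \<open>coord_vec M C p v\<close> is the derivation
  \<open>\<Sum>i. v\<^sub>i \<partial>/\<partial>x\<^sup>i\<close> at \<open>p\<close> given by the chart \<open>C\<close>.\<close>

type_synonym 'a tangent = "('a \<Rightarrow> real) \<Rightarrow> real"

definition coord_vec ::
  "('a, 'e::euclidean_space) mfd \<Rightarrow> ('a, 'e) chart \<Rightarrow> 'a \<Rightarrow> 'e \<Rightarrow> 'a tangent"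
where
  "coord_vec M C p v =
     (\<lambda>u. if smooth_near M p u then ddir (u \<circ> chart_inv C) v (snd C p) else 0)"

definition tangent_space :: "('a, 'e::euclidean_space) mfd \<Rightarrow> 'a \<Rightarrow> 'a tangent set" where
  "tangent_space M p = {coord_vec M C p v | C v. C \<in> atlas M \<and> p \<in> chart_dom C}"

text \<open>The differential at \<open>p\<close> of a smooth map \<open>\<phi>\<close> with values in \<open>N\<close>.\<close>

definition differential ::
  "('b, 'f::euclidean_space) mfd \<Rightarrow> ('a \<Rightarrow> 'b) \<Rightarrow> 'a \<Rightarrow> 'a tangent \<Rightarrow> 'b tangent"
where
  "differential N \<phi> p X = (\<lambda>u. if smooth_near N (\<phi> p) u then X (u \<circ> \<phi>) else 0)"


section \<open>Semi-Riemannian metrics\<close>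

text \<open>The values of a metric at \<open>p\<close> matter only on pairs of vectors of the tangent space at
  \<open>p\<close>. Since manifolds are connected, the index of a nondegenerate continuous metric is
  automatically constant.\<close>

type_synonym 'a metric_tensor = "'a \<Rightarrow> 'a tangent \<Rightarrow> 'a tangent \<Rightarrow> real"

definition metric_coeff ::
  "('a, 'e::euclidean_space) mfd \<Rightarrow> 'a metric_tensor \<Rightarrow> ('a, 'e) chart \<Rightarrow> 'e \<Rightarrow> 'e \<Rightarrow> 'e \<Rightarrow> real"
where
  "metric_coeff M g C x v w =
     g (chart_inv C x) (coord_vec M C (chart_inv C x) v) (coord_vec M C (chart_inv C x) w)"

definition semi_riemannian ::
  "('a, 'e::euclidean_space) mfd \<Rightarrow> 'a metric_tensor \<Rightarrow> bool"
where
  "semi_riemannian M g \<longleftrightarrow>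
     smooth_manifold M \<and>
     (\<forall>p\<in>points M. \<forall>X\<in>tangent_space M p. \<forall>Y\<in>tangent_space M p. g p X Y = g p Y X) \<and>
     (\<forall>p\<in>points M. \<forall>X\<in>tangent_space M p. \<forall>Y\<in>tangent_space M p. \<forall>Z\<in>tangent_space M p. \<forall>a b.
        g p (\<lambda>u. a * X u + b * Y u) Z = a * g p X Z + b * g p Y Z) \<and>
     (\<forall>p\<in>points M. \<forall>X\<in>tangent_space M p.
        (\<forall>Y\<in>tangent_space M p. g p X Y = 0) \<longrightarrow> X = (\<lambda>u. 0)) \<and>
     (\<forall>C\<in>atlas M. \<forall>v w. Cinf_on (chart_img C) (\<lambda>x. metric_coeff M g C x v w))"


section \<open>Levi-Civita connection, Hessian and Ricci tensor in coordinates\<close>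

text \<open>For constant vectors \<open>v\<close>, \<open>w\<close>, regarded as coordinate vector fields of the chart \<open>C\<close>,
  \<open>christoffel M g C x v w\<close> is the coordinate expression of \<open>\<nabla>\<^sub>v w\<close>, i.e. its components are
  the sums of \<open>\<Gamma>\<^sup>k\<^sub>i\<^sub>j v\<^sub>i w\<^sub>j\<close>. It is determined by the Koszul formula, in which the Lie brackets
  vanish for such fields.\<close>

definition christoffel ::
  "('a, 'e::euclidean_space) mfd \<Rightarrow> 'a metric_tensor \<Rightarrow> ('a, 'e) chart \<Rightarrow> 'e \<Rightarrow> 'e \<Rightarrow> 'e \<Rightarrow> 'e"
where
  "christoffel M g C x v w = (THE z. \<forall>u.
     2 * metric_coeff M g C x z u =
       ddir (\<lambda>y. metric_coeff M g C y w u) v x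
     + ddir (\<lambda>y. metric_coeff M g C y v u) w x
     - ddir (\<lambda>y. metric_coeff M g C y v w) u x)"

text \<open>\<open>Hess(h)(v, w) = v(w(h)) - (\<nabla>\<^sub>v w)(h)\<close> for coordinate vector fields.\<close>

definition hessian ::
  "('a, 'e::euclidean_space) mfd \<Rightarrow> 'a metric_tensor \<Rightarrow> ('a \<Rightarrow> real) \<Rightarrow> ('a, 'e) chart
     \<Rightarrow> 'e \<Rightarrow> 'e \<Rightarrow> 'e \<Rightarrow> real"
where
  "hessian M g h C x v w =
     ddir (\<lambda>y. ddir (h \<circ> chart_inv C) w y) v x
     - ddir (h \<circ> chart_inv C) (christoffel M g C x v w) x"

text \<open>\<open>R(v, w) z = \<nabla>\<^sub>v \<nabla>\<^sub>w z - \<nabla>\<^sub>w \<nabla>\<^sub>v z\<close> for coordinate vector fields.\<close>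

definition riemann ::
  "('a, 'e::euclidean_space) mfd \<Rightarrow> 'a metric_tensor \<Rightarrow> ('a, 'e) chart
     \<Rightarrow> 'e \<Rightarrow> 'e \<Rightarrow> 'e \<Rightarrow> 'e \<Rightarrow> 'e"
where
  "riemann M g C x v w z =
     ddir (\<lambda>y. christoffel M g C y w z) v x
     - ddir (\<lambda>y. christoffel M g C y v z) w x
     + christoffel M g C x v (christoffel M g C x w z)
     - christoffel M g C x w (christoffel M g C x v z)"

text \<open>\<open>Ric(w, z)\<close> is the trace of \<open>v \<mapsto> R(v, w) z\<close>; with this convention round spheres have
  positive Ricci curvature. The inner product only extracts components with respect to the
  coordinate basis and has nothing to do with \<open>g\<close>.\<close>

definition ricci ::
  "('a, 'e::euclidean_space) mfd \<Rightarrow> 'a metric_tensor \<Rightarrow> ('a, 'e) chart \<Rightarrow> 'e \<Rightarrow> 'e \<Rightarrow> 'e \<Rightarrow> real"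
where
  "ricci M g C x w z = (\<Sum>b\<in>Basis. riemann M g C x b w z \<bullet> b)"

text \<open>The tensor equation \<open>Ric + Hess(h) = \<rho> g\<close> is required for its components in every
  chart of the atlas.\<close>

definition gradient_ricci_soliton ::
  "('a, 'e::euclidean_space) mfd \<Rightarrow> 'a metric_tensor \<Rightarrow> ('a \<Rightarrow> real) \<Rightarrow> real \<Rightarrow> bool"
where
  "gradient_ricci_soliton M g h \<rho> \<longleftrightarrow>
     semi_riemannian M g \<and> 3 \<le> DIM('e) \<and> smooth_fun_on M (points M) h \<and>
     (\<forall>C\<in>atlas M. \<forall>x\<in>chart_img C. \<forall>v w.
        ricci M g C x v w + hessian M g h C x v w = \<rho> * metric_coeff M g C x v w)"


section \<open>Warped products\<close>

definition warped_metric ::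
  "('a, 'e::euclidean_space) mfd \<Rightarrow> 'a metric_tensor \<Rightarrow> ('a \<Rightarrow> real)
     \<Rightarrow> ('b, 'f::euclidean_space) mfd \<Rightarrow> 'b metric_tensor \<Rightarrow> ('a \<times> 'b) metric_tensor"
where
  "warped_metric B gB f F gF = (\<lambda>z X Y.
     gB (fst z) (differential B fst z X) (differential B fst z Y)
     + (f (fst z))\<^sup>2 * gF (snd z) (differential F snd z X) (differential F snd z Y))"

end

theory Submission
  imports Defs
begin

text \<open>In a product chart, let \<open>x\<close> be the coordinates on the base, \<open>y\<close> those on the fiber,
  \<open>\<phi>\<close> and \<open>H\<close> the coordinate expressions of \<open>f\<close> and \<open>h\<close>, \<open>a\<close> and \<open>c\<close> horizontal
  vectors and \<open>d\<close> a vertical one. The Ricci tensor of a warped product vanishes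
  on mixed pairs, so the soliton equation for \<open>(a, d)\<close> reads
  \<open>\<partial>\<^sub>a \<partial>\<^sub>d H = (\<partial>\<^sub>a \<phi> / \<phi>) \<partial>\<^sub>d H\<close>, that is, \<open>\<partial>\<^sub>d H / \<phi>\<close> does not depend on
  \<open>x\<close>. Hence \<open>H(x, y) - H(x, y') = K \<phi>(x)\<close> locally, with \<open>K\<close> independent of \<open>x\<close>; as the base
  is connected, \<open>(h(p, q) - h(p, q')) / f(p)\<close> is independent of \<open>p\<close> whenever \<open>q\<close>, \<open>q'\<close> are close.
  On horizontal pairs the Ricci tensor does not depend on \<open>y\<close>. Subtracting the soliton equations
  for \<open>(a, c)\<close> at \<open>y\<close> and \<open>y'\<close> therefore gives \<open>K Hess(\<phi>)(a, c) = 0\<close>, so \<open>K = 0\<close>. Thus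
  \<open>h(p, _)\<close> is locally constant on the connected fiber.\<close>

section \<open>Calculus of C^k maps on open sets\<close>

lemma frechet_derivative_cong_open:
  assumes "open S" "x \<in> S" "\<And>y. y \<in> S \<Longrightarrow> u y = v y"
  shows "frechet_derivative u (at x) = frechet_derivative v (at x)"
proof -
  \<comment> \<open>\<open>frechet_derivative\<close> chooses from the set of all derivatives at the
    point. Functions that agree near x have the same such set, so the two choices agree even where
    that set is empty.\<close>
  have "(u has_derivative D) (at x) \<longleftrightarrow> (v has_derivative D) (at x)" for D
    using assms has_derivative_transform_within_open[of u D x UNIV S v]
      has_derivative_transform_within_open[of v D x UNIV S u] by auto
  then show ?thesis by (simp add: frechet_derivative_def)
qed

text \<open>The standard way to compute a derivative below: most functions are known by an explicit
  formula only on an open set, such as the image of a chart.\<close>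

lemma ddir_eqI:
  assumes "open S" "x \<in> S" "\<And>y. y \<in> S \<Longrightarrow> u y = v y" "(v has_derivative D) (at x)"
  shows "ddir u c x = D c"
  using frechet_derivative_cong_open[where u = u, OF assms(1-3)] frechet_derivative_at[OF assms(4)]
  by simp

lemma differentiable_cong_open:
  assumes "open S" "x \<in> S" "\<And>y. y \<in> S \<Longrightarrow> u y = v y"
  shows "u differentiable (at x) \<longleftrightarrow> v differentiable (at x)"
  using assms has_derivative_transform_within_open[of u _ x UNIV S v]
    has_derivative_transform_within_open[of v _ x UNIV S u]
  unfolding differentiable_def by metis

lemma Ck_on_cong:
  assumes "open S" "\<And>x. x \<in> S \<Longrightarrow> u x = v x"
  shows "Ck_on k S u \<longleftrightarrow> Ck_on k S v"
  using assms
proof (induction k arbitrary: u v)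
  case 0
  then show ?case by (simp cong: continuous_on_cong)
next
  case (Suc k)
  have "ddir u c x = ddir v c x" if "x \<in> S" for c x
    using frechet_derivative_cong_open[OF Suc.prems(1) that Suc.prems(2)] by simp
  then have "Ck_on k S (ddir u c) \<longleftrightarrow> Ck_on k S (ddir v c)" for c
    using Suc.prems(1) by (intro Suc.IH) auto
  moreover have "(\<forall>x\<in>S. u differentiable (at x)) \<longleftrightarrow> (\<forall>x\<in>S. v differentiable (at x))"
    using differentiable_cong_open[where u = u and v = v, OF Suc.prems(1) _ Suc.prems(2)] by blast
  ultimately show ?case by simp
qed

lemma ddir_compose_linear:
  fixes u :: "'e::real_normed_vector \<Rightarrow> 'x::real_normed_vector"
  assumes "bounded_linear L" "u differentiable (at (L x))"
  shows "((\<lambda>z. u (L z)) has_derivative (\<lambda>v. ddir u (L v) (L x))) (at x)"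
proof -
  have "(L has_derivative L) (at x)"
    using assms(1) by (rule bounded_linear_imp_has_derivative)
  moreover have "(u has_derivative frechet_derivative u (at (L x))) (at (L x))"
    using assms(2) frechet_derivative_works by blast
  ultimately show ?thesis
    using has_derivative_compose by blast
qed

text \<open>The derivative of a linear map is constant, so each directional derivative of the
  composition is again a composition with the same L. This keeps the induction within one form; it
  is applied to the projections of a product.\<close>

lemma Ck_on_compose_linear:
  assumes "bounded_linear L" "open S" "Ck_on k S u" "open T" "L ` T \<subseteq> S"
  shows "Ck_on k T (\<lambda>z. u (L z))"
  using assms(3)
proof (induction k arbitrary: u)
  case 0
  moreover have "continuous_on T L"
    using assms(1) by (simp add: linear_continuous_on)
  ultimately show ?case
    using assms(5) by (auto intro: continuous_on_compose2)
next
  case (Suc k)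
  have der: "((\<lambda>z. u (L z)) has_derivative (\<lambda>v. ddir u (L v) (L z))) (at z)" if "z \<in> T" for z
    using Suc.prems assms(5) that by (intro ddir_compose_linear[OF assms(1)]) auto
  have "Ck_on k T (\<lambda>z. ddir u (L v) (L z))" for v
    using Suc.prems by (intro Suc.IH) simp
  moreover have "ddir (\<lambda>z. u (L z)) v z = ddir u (L v) (L z)" if "z \<in> T" for v z
    using frechet_derivative_at[OF der[OF that]] by metis
  ultimately have "Ck_on k T (ddir (\<lambda>z. u (L z)) v)" for v
    using Ck_on_cong[OF assms(4), of "ddir (\<lambda>z. u (L z)) v" "\<lambda>z. ddir u (L v) (L z)"] by blast
  then show ?case
    using der by (auto simp: differentiable_def)
qed

lemma Ck_on_linear_compose:
  assumes "bounded_linear L" "open S" "Ck_on k S u"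
  shows "Ck_on k S (\<lambda>z. L (u z))"
  using assms(3)
proof (induction k arbitrary: u)
  case 0
  then show ?case
    using assms(1) by (auto intro: bounded_linear.continuous_on)
next
  case (Suc k)
  have der: "((\<lambda>z. L (u z)) has_derivative (\<lambda>v. L (ddir u v z))) (at z)" if "z \<in> S" for z
    using Suc.prems that
    by (auto intro!: bounded_linear.has_derivative[OF assms(1)] simp: frechet_derivative_works)
  have "Ck_on k S (\<lambda>z. L (ddir u v z))" for v
    using Suc.prems by (intro Suc.IH) simp
  moreover have "ddir (\<lambda>z. L (u z)) v z = L (ddir u v z)" if "z \<in> S" for v z
    using frechet_derivative_at[OF der[OF that]] by metis
  ultimately have "Ck_on k S (ddir (\<lambda>z. L (u z)) v)" for v
    using Ck_on_cong[OF assms(2), of "ddir (\<lambda>z. L (u z)) v" "\<lambda>z. L (ddir u v z)"] by blast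
  then show ?case
    using der by (auto simp: differentiable_def)
qed

lemma Ck_on_2D:
  assumes "Ck_on 2 S u" "x \<in> S"
  shows "u differentiable (at x)" "ddir u v differentiable (at x)"
  using assms by (auto simp: numeral_2_eq_2)

section \<open>Metrics on open subsets of Euclidean spaces\<close>

text \<open>Order 2 is what makes the Christoffel symbols differentiable, as the Ricci tensor
  requires. Nondegeneracy replaces definiteness, so every signature is covered.\<close>

definition metric_on :: "'e::euclidean_space set \<Rightarrow> ('e \<Rightarrow> 'e \<Rightarrow> 'e \<Rightarrow> real) \<Rightarrow> bool" where
  "metric_on U \<gamma> \<longleftrightarrow> open U \<and>
     (\<forall>x\<in>U. bilinear (\<gamma> x) \<and> (\<forall>v w. \<gamma> x v w = \<gamma> x w v) \<and> (\<forall>v. (\<forall>w. \<gamma> x v w = 0) \<longrightarrow> v = 0)) \<and>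
     (\<forall>v w. Ck_on 2 U (\<lambda>x. \<gamma> x v w))"

text \<open>Twice the Christoffel symbols of the first kind; the Lie brackets of the constant fields
  v, w, u vanish.\<close>

definition koszul :: "('e::real_normed_vector \<Rightarrow> 'e \<Rightarrow> 'e \<Rightarrow> real) \<Rightarrow> 'e \<Rightarrow> 'e \<Rightarrow> 'e \<Rightarrow> 'e \<Rightarrow> real" where
  "koszul \<gamma> x v w u =
     ddir (\<lambda>y. \<gamma> y w u) v x + ddir (\<lambda>y. \<gamma> y v u) w x - ddir (\<lambda>y. \<gamma> y v w) u x"

text \<open>\<open>christoffel\<close> depends on manifold and chart only through
  \<open>metric_coeff\<close>. Taking the coefficient function itself as argument lets the local
  computations take place in Euclidean space.\<close>

definition levi_civita :: "('e::euclidean_space \<Rightarrow> 'e \<Rightarrow> 'e \<Rightarrow> real) \<Rightarrow> 'e \<Rightarrow> 'e \<Rightarrow> 'e \<Rightarrow> 'e" where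
  "levi_civita \<gamma> x v w = (THE z. \<forall>u. 2 * \<gamma> x z u = koszul \<gamma> x v w u)"

text \<open>Lowering of an index: the covector \<open>\<gamma> x v\<close>, turned into a vector by
  the Euclidean inner product. Nondegeneracy of the form becomes injectivity of this linear
  map.\<close>

definition gram :: "('e::euclidean_space \<Rightarrow> 'e \<Rightarrow> 'e \<Rightarrow> real) \<Rightarrow> 'e \<Rightarrow> 'e \<Rightarrow> 'e" where
  "gram \<gamma> x v = (\<Sum>b\<in>Basis. \<gamma> x v b *\<^sub>R b)"

lemma real_functional_eq_sum:
  fixes L :: "'e::euclidean_space \<Rightarrow> real"
  assumes "linear L"
  shows "L u = (\<Sum>b\<in>Basis. (u \<bullet> b) * L b)"
  using assms by (subst euclidean_representation[of u, symmetric])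
    (simp add: linear_sum linear_cmul del: euclidean_representation)

text \<open>As g is merely continuous, the product rule does not apply. Instead F is O(norm (y - x))
  and g tends to 0, so the product is o(norm (y - x)).\<close>

lemma has_derivative_scaleR_vanishing:
  fixes g :: "'e::real_normed_vector \<Rightarrow> real" and F :: "'e \<Rightarrow> 'x::real_normed_vector"
  assumes F: "F differentiable (at x)" "F x = 0" and g: "continuous (at x) g" "g x = 0"
  shows "((\<lambda>y. g y *\<^sub>R F y) has_derivative (\<lambda>_. 0)) (at x)"
proof -
  obtain F' where "(F has_derivative F') (at x)"
    using F by (auto simp: differentiable_def)
  then have F': "bounded_linear F'"
      "\<And>e. e > 0 \<Longrightarrow> \<exists>d>0. \<forall>y. norm (y - x) < d \<longrightarrow> norm (F y - F x - F' (y - x)) \<le> e * norm (y - x)"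
    unfolding has_derivative_at_alt by auto
  obtain K where K: "K > 0" "\<And>v. norm (F' v) \<le> norm v * K"
    using bounded_linear.pos_bounded[OF F'(1)] by auto
  obtain d where d: "d > 0" "\<And>y. norm (y - x) < d \<Longrightarrow> norm (F y - F' (y - x)) \<le> norm (y - x)"
    using F'(2)[of 1] F(2) by auto
  have bound: "norm (F y) \<le> (1 + K) * norm (y - x)" if "norm (y - x) < d" for y
    using d(2)[OF that] K(2)[of "y - x"] norm_triangle_sub[of "F y" "F' (y - x)"]
    by (simp add: algebra_simps)
  show ?thesis
    unfolding has_derivative_at_alt
  proof (intro conjI allI impI)
    fix e :: real assume e: "e > 0"
    \<comment> \<open>By \<open>bound\<close>, F grows at most by the factor 1 + K; this tolerance
      for g cancels that factor.\<close>
    then have "e / (1 + K) > 0" using K(1) by simp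
    then obtain d' where d': "d' > 0" "\<And>y. dist y x < d' \<Longrightarrow> dist (g y) (g x) < e / (1 + K)"
      using g(1) unfolding continuous_at_eps_delta by blast
    show "\<exists>d>0. \<forall>y. norm (y - x) < d \<longrightarrow> norm (g y *\<^sub>R F y - g x *\<^sub>R F x - 0) \<le> e * norm (y - x)"
    proof (intro exI[of _ "min d d'"] conjI allI impI)
      fix y assume y: "norm (y - x) < min d d'"
      have "\<bar>g y\<bar> * norm (F y) \<le> e / (1 + K) * ((1 + K) * norm (y - x))"
        using d'(2)[of y] bound[of y] y g(2) e K(1)
        by (intro mult_mono) (auto simp: dist_norm)
      also have "\<dots> = e * norm (y - x)"
        using K(1) by simp
      finally show "norm (g y *\<^sub>R F y - g x *\<^sub>R F x - 0) \<le> e * norm (y - x)"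
        using F(2) by simp
    qed (use d d' in auto)
  qed simp
qed

lemma christoffel_eq_levi_civita: "christoffel M g C = levi_civita (metric_coeff M g C)"
  by (intro ext) (simp add: christoffel_def levi_civita_def koszul_def)

text \<open>Phrased at a single point and with bare nondegeneracy, so that it also serves the warped
  metric, for which only bilinearity and nondegeneracy at points are established.\<close>

lemma levi_civita_unique:
  assumes "bilinear (\<gamma> x)" "\<And>v. (\<And>w. \<gamma> x v w = 0) \<Longrightarrow> v = 0"
    and "\<And>u. 2 * \<gamma> x z u = koszul \<gamma> x v w u"
  shows "levi_civita \<gamma> x v w = z"
  unfolding levi_civita_def
proof (rule the_equality)
  fix z' assume "\<forall>u. 2 * \<gamma> x z' u = koszul \<gamma> x v w u"
  then have "2 * \<gamma> x z' u = 2 * \<gamma> x z u" for u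
    using assms(3) by simp
  then have "\<gamma> x (z' - z) u = 0" for u
    using bilinear_lsub[OF assms(1)] by simp
  then show "z' = z"
    using assms(2)[of "z' - z"] by simp
qed (use assms(3) in blast)

section \<open>The Levi-Civita connection of a nondegenerate metric in coordinates\<close>

context
  fixes U :: "'e::euclidean_space set" and \<gamma> :: "'e \<Rightarrow> 'e \<Rightarrow> 'e \<Rightarrow> real"
  assumes metric: "metric_on U \<gamma>"
begin

lemma metric_open: "open U"
  using metric by (simp add: metric_on_def)

context
  fixes x
  assumes x: "x \<in> U"
begin

lemma metric_bilinear: "bilinear (\<gamma> x)"
  and metric_nondegenerate: "(\<And>w. \<gamma> x v w = 0) \<Longrightarrow> v = 0"
  and metric_differentiable: "(\<lambda>y. \<gamma> y v w) differentiable (at x)"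
  and metric_ddir_differentiable: "ddir (\<lambda>y. \<gamma> y v w) u differentiable (at x)"
  using metric x Ck_on_2D[OF _ x, of "\<lambda>y. \<gamma> y v w" for v w] by (auto simp: metric_on_def)

lemma metric_linear_right: "linear (\<gamma> x v)"
  using metric_bilinear by (simp add: bilinear_def)

lemma linear_gram: "linear (gram \<gamma> x)"
  unfolding gram_def using metric_bilinear
  by (auto intro!: linearI simp: bilinear_ladd bilinear_lmul scaleR_add_left sum.distrib scaleR_sum_right)

lemma inj_gram: "inj (gram \<gamma> x)"
  unfolding linear_injective_0[OF linear_gram]
proof (intro allI impI)
  fix v assume "gram \<gamma> x v = 0"
  then have "\<gamma> x v b = 0" if "b \<in> Basis" for b
    using that by (metis gram_def inner_sum_left_Basis inner_zero_left)
  then have "\<gamma> x v u = 0" for u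
    by (subst real_functional_eq_sum[OF metric_linear_right]) simp
  then show "v = 0" by (rule metric_nondegenerate)
qed

text \<open>Riesz representation for an indefinite form: an injective endomorphism of a
  finite-dimensional space is surjective, so the lowering map reaches every covector.\<close>

lemma metric_representation:
  assumes "linear (K :: 'e \<Rightarrow> real)"
  obtains z where "\<And>u. \<gamma> x z u = K u"
proof -
  have "surj (gram \<gamma> x)"
    using linear_injective_imp_surjective[OF linear_gram inj_gram] by simp
  then obtain z where z: "gram \<gamma> x z = (\<Sum>b\<in>Basis. K b *\<^sub>R b)"
    by (metis surjD)
  have "\<gamma> x z b = K b" if "b \<in> Basis" for b
    using arg_cong[OF z, of "\<lambda>a. a \<bullet> b"] that by (simp add: gram_def)
  then have "\<gamma> x z u = K u" for u
    by (subst real_functional_eq_sum[OF metric_linear_right], subst real_functional_eq_sum[OF assms]) simp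
  then show ?thesis by (rule that)
qed

lemma metric_ddir_scaleR:
  "ddir (\<lambda>y. \<gamma> y (r *\<^sub>R a) c) b x = r * ddir (\<lambda>y. \<gamma> y a c) b x"
  "ddir (\<lambda>y. \<gamma> y a (r *\<^sub>R c)) b x = r * ddir (\<lambda>y. \<gamma> y a c) b x"
proof -
  have "((\<lambda>y. r * \<gamma> y a c) has_derivative (\<lambda>b. r * ddir (\<lambda>y. \<gamma> y a c) b x)) (at x)"
    using frechet_derivative_works[THEN iffD1, OF metric_differentiable]
    by (intro has_derivative_mult_right) auto
  then have *: "ddir u b x = r * ddir (\<lambda>y. \<gamma> y a c) b x"
    if "\<And>y. y \<in> U \<Longrightarrow> u y = r * \<gamma> y a c" for u
    using ddir_eqI[where u = u, OF metric_open x that] by simp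
  show "ddir (\<lambda>y. \<gamma> y (r *\<^sub>R a) c) b x = r * ddir (\<lambda>y. \<gamma> y a c) b x"
    by (rule *) (use metric in \<open>simp add: metric_on_def bilinear_lmul\<close>)
  show "ddir (\<lambda>y. \<gamma> y a (r *\<^sub>R c)) b x = r * ddir (\<lambda>y. \<gamma> y a c) b x"
    by (rule *) (use metric in \<open>simp add: metric_on_def bilinear_rmul\<close>)
qed

lemma linear_koszul: "linear (koszul \<gamma> x v w)"
proof -
  have 1: "linear (\<lambda>u. ddir (\<lambda>y. \<gamma> y a u) b x)" for a b
  proof (rule linearI)
    fix c d
    have "((\<lambda>y. \<gamma> y a c + \<gamma> y a d) has_derivative
        (\<lambda>b. ddir (\<lambda>y. \<gamma> y a c) b x + ddir (\<lambda>y. \<gamma> y a d) b x)) (at x)"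
      using frechet_derivative_works[THEN iffD1, OF metric_differentiable]
      by (intro has_derivative_add) auto
    then show "ddir (\<lambda>y. \<gamma> y a (c + d)) b x = ddir (\<lambda>y. \<gamma> y a c) b x + ddir (\<lambda>y. \<gamma> y a d) b x"
      using metric by (intro ddir_eqI[OF metric_open x, of _ "\<lambda>y. \<gamma> y a c + \<gamma> y a d"])
        (simp_all add: metric_on_def bilinear_radd)
  qed (simp add: metric_ddir_scaleR)
  \<comment> \<open>In the third Koszul term u is the direction of differentiation, so linearity is
    that of the derivative itself.\<close>
  have 2: "linear (\<lambda>u. ddir (\<lambda>y. \<gamma> y v w) u x)"
    using linear_frechet_derivative[OF metric_differentiable] .
  show ?thesis
    unfolding koszul_def
    by (rule linear_compose_sub[OF linear_compose_add[OF 1[of w v] 1[of v w]] 2])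
qed

lemma levi_civita_eqI:
  assumes "\<And>u. 2 * \<gamma> x z u = koszul \<gamma> x v w u"
  shows "levi_civita \<gamma> x v w = z"
  by (rule levi_civita_unique[where \<gamma> = \<gamma>, OF metric_bilinear _ assms]) (rule metric_nondegenerate)

text \<open>Existence for the \<open>THE\<close> in \<open>levi_civita\<close>: half the Koszul
  expression is linear in u and is therefore represented by a vector.\<close>

lemma levi_civita_koszul: "2 * \<gamma> x (levi_civita \<gamma> x v w) u = koszul \<gamma> x v w u"
proof -
  have "linear (\<lambda>u. (1/2) *\<^sub>R koszul \<gamma> x v w u)"
    by (intro linear_compose_scale_right linear_koszul)
  then obtain z where z: "\<And>u. \<gamma> x z u = (1/2) *\<^sub>R koszul \<gamma> x v w u"
    using metric_representation by metis
  then have eq: "2 * \<gamma> x z u = koszul \<gamma> x v w u" for u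
    by (simp only: z) simp
  note this[of u]
  moreover have "levi_civita \<gamma> x v w = z"
    by (rule levi_civita_eqI) (rule eq)
  ultimately show ?thesis
    by simp
qed

text \<open>Homogeneity is the part of bilinearity that the curvature computation uses: it gives the
  value 0 on zero arguments and moves the factor \<open>dlog\<close> out of the fiber connection in
  \<open>ricci_mixed\<close>.\<close>

lemma levi_civita_scaleR:
  "levi_civita \<gamma> x (r *\<^sub>R v) w = r *\<^sub>R levi_civita \<gamma> x v w"
  "levi_civita \<gamma> x v (r *\<^sub>R w) = r *\<^sub>R levi_civita \<gamma> x v w"
proof -
  have "koszul \<gamma> x (r *\<^sub>R v) w u = r * koszul \<gamma> x v w u" "koszul \<gamma> x v (r *\<^sub>R w) u = r * koszul \<gamma> x v w u" for u
    using linear_cmul[OF linear_frechet_derivative[OF metric_differentiable]]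
    by (simp_all add: koszul_def metric_ddir_scaleR algebra_simps)
  moreover have "2 * \<gamma> x (r *\<^sub>R levi_civita \<gamma> x v w) u = r * koszul \<gamma> x v w u" for u
    using levi_civita_koszul[of v w u] by (simp add: bilinear_lmul[OF metric_bilinear] mult.left_commute[of 2 r])
  ultimately show "levi_civita \<gamma> x (r *\<^sub>R v) w = r *\<^sub>R levi_civita \<gamma> x v w"
      "levi_civita \<gamma> x v (r *\<^sub>R w) = r *\<^sub>R levi_civita \<gamma> x v w"
    by (intro levi_civita_eqI; simp)+
qed

lemma levi_civita_zero: "levi_civita \<gamma> x 0 w = 0" "levi_civita \<gamma> x v 0 = 0"
  using levi_civita_scaleR(1)[of 0] levi_civita_scaleR(2)[of _ 0] by simp_all

end

section \<open>Differentiability of the connection\<close>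

lemma gram_differentiable:
  assumes x: "x \<in> U"
  shows "(\<lambda>y. gram \<gamma> y v) differentiable (at x)"
  unfolding gram_def
  by (intro differentiable_sum ballI differentiable_scaleR metric_differentiable[OF x] differentiable_const) auto

text \<open>The difference \<open>E y = z y - z x\<close> satisfies \<open>gram x (E y) = r y - (gram y - gram x) (E y)\<close>,
  where \<open>r\<close> is differentiable and vanishes at \<open>x\<close>, and the last term is of second order because
  \<open>E\<close> is continuous.\<close>

lemma differentiable_if_gram_differentiable:
  assumes x: "x \<in> U"
    and k: "(\<lambda>y. gram \<gamma> y (z y)) differentiable (at x)"
  shows "z differentiable (at x)"
proof -
  define E where "E y = z y - z x" for y
  define r where "r y = gram \<gamma> y (z y) - gram \<gamma> y (z x)" for y
  define T where "T c y = gram \<gamma> y c - gram \<gamma> x c" for c y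
  have lin: "linear (gram \<gamma> y)" if "y \<in> U" for y
    using linear_gram[OF that] .
  have r: "r differentiable (at x)" "r x = 0"
    unfolding r_def by (intro differentiable_diff k gram_differentiable[OF x]) simp
  have T: "T c differentiable (at x)" "T c x = 0" for c
    unfolding T_def by (intro differentiable_diff gram_differentiable[OF x] differentiable_const) simp
  have sum: "gram \<gamma> y u - gram \<gamma> x u = (\<Sum>c\<in>Basis. (u \<bullet> c) *\<^sub>R T c y)" if "y \<in> U" for y u
  proof -
    have "L u = (\<Sum>c\<in>Basis. (u \<bullet> c) *\<^sub>R L c)" if "linear L" for L :: "'e \<Rightarrow> 'e"
      using that by (subst euclidean_representation[of u, symmetric])
        (simp add: linear_sum linear_cmul del: euclidean_representation)
    from this[OF linear_compose_sub[OF lin[OF that] linear_gram[OF x]]]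
    show ?thesis by (simp add: T_def)
  qed
  have rE: "gram \<gamma> x (E y) = r y - (\<Sum>c\<in>Basis. (E y \<bullet> c) *\<^sub>R T c y)" if "y \<in> U" for y
    using sum[OF that, of "E y"] linear_diff[OF lin[OF that], of "z y" "z x"]
    by (simp add: E_def r_def algebra_simps)
  \<comment> \<open>Lower bound of an injective linear map. Once the norms of \<open>T c y\<close>
    sum to less than half of it, the correction term in \<open>rE\<close> is absorbed into the
    left-hand side and E is bounded by a multiple of r.\<close>
  obtain \<beta> where \<beta>: "\<beta> > 0" "\<And>u. \<beta> * norm u \<le> norm (gram \<gamma> x u)"
    using linear_inj_bounded_below_pos[OF linear_gram[OF x] inj_gram[OF x]] by metis
  have "((\<lambda>y. \<Sum>c\<in>Basis. norm (T c y)) \<longlongrightarrow> (\<Sum>c\<in>Basis. norm (T c x))) (at x)"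
    using T(1) by (intro tendsto_sum tendsto_norm)
      (metis differentiable_imp_continuous_within isCont_def)
  then have "\<forall>\<^sub>F y in at x. (\<Sum>c\<in>Basis. norm (T c y)) < \<beta> / 2"
    using T(2) \<beta>(1) by (intro order_tendstoD(2)) auto
  moreover have "\<forall>\<^sub>F y in at x. y \<in> U"
    using metric_open x by (simp add: eventually_at_topological) blast
  ultimately have "\<forall>\<^sub>F y in at x. norm (E y) \<le> 2 / \<beta> * norm (r y)"
  proof eventually_elim
    case (elim y)
    have "norm (\<Sum>c\<in>Basis. (E y \<bullet> c) *\<^sub>R T c y) \<le> (\<Sum>c\<in>Basis. norm (E y) * norm (T c y))"
      by (intro sum_norm_le) (simp add: mult_right_mono Basis_le_norm)
    also have "\<dots> \<le> norm (E y) * (\<beta> / 2)"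
      using mult_left_mono[OF less_imp_le[OF elim(1)] norm_ge_zero[of "E y"]]
      by (simp only: sum_distrib_left)
    finally have "\<beta> * norm (E y) \<le> norm (r y) + norm (E y) * (\<beta> / 2)"
      using \<beta>(2)[of "E y"] rE[OF elim(2)] norm_triangle_ineq4[of "r y" "\<Sum>c\<in>Basis. (E y \<bullet> c) *\<^sub>R T c y"]
      by simp
    then show ?case
      using \<beta>(1) by (simp add: field_simps)
  qed
  moreover have "((\<lambda>y. 2 / \<beta> * norm (r y)) \<longlongrightarrow> 2 / \<beta> * norm (r x)) (at x)"
    using r(1) by (intro tendsto_mult tendsto_const tendsto_norm)
      (metis differentiable_imp_continuous_within isCont_def)
  then have "((\<lambda>y. 2 / \<beta> * norm (r y)) \<longlongrightarrow> 0) (at x)"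
    using r(2) by simp
  ultimately have "(E \<longlongrightarrow> 0) (at x)"
    by (rule Lim_null_comparison)
  then have E: "continuous (at x) (\<lambda>y. E y \<bullet> c)" "E x \<bullet> c = 0" for c
    using tendsto_inner[of E 0 "at x" "\<lambda>_. c" c] by (auto simp: isCont_def E_def)
  have "(\<lambda>y. (E y \<bullet> c) *\<^sub>R T c y) differentiable (at x)" for c
    using has_derivative_scaleR_vanishing[OF T E] by (auto simp: differentiable_def)
  then have "(\<lambda>y. r y - (\<Sum>c\<in>Basis. (E y \<bullet> c) *\<^sub>R T c y)) differentiable (at x)"
    using r(1) by (intro differentiable_diff differentiable_sum ballI) auto
  then have gE: "(\<lambda>y. gram \<gamma> x (E y)) differentiable (at x)"
    using differentiable_cong_open[where u = "\<lambda>y. gram \<gamma> x (E y)"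
        and v = "\<lambda>y. r y - (\<Sum>c\<in>Basis. (E y \<bullet> c) *\<^sub>R T c y)", OF metric_open x rE] by blast
  obtain L where L: "linear L" "L \<circ> gram \<gamma> x = id"
    using linear_injective_left_inverse[OF linear_gram[OF x] inj_gram[OF x]] by blast
  have L_gram: "L (gram \<gamma> x v) = v" for v
    using L(2) by (metis comp_apply id_apply)
  obtain D where "((\<lambda>y. gram \<gamma> x (E y)) has_derivative D) (at x)"
    using gE by (auto simp: differentiable_def)
  moreover have "bounded_linear L"
    using L(1) linear_conv_bounded_linear by blast
  ultimately have "((\<lambda>y. z x + L (gram \<gamma> x (E y))) has_derivative (\<lambda>v. 0 + L (D v))) (at x)"
    by (intro has_derivative_add has_derivative_const) (rule bounded_linear.has_derivative)
  then have "(\<lambda>y. z x + L (gram \<gamma> x (E y))) differentiable (at x)"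
    unfolding differentiable_def by blast
  also have "(\<lambda>y. z x + L (gram \<gamma> x (E y))) = z"
    by (simp add: L_gram E_def)
  finally show ?thesis .
qed

text \<open>With lowered index the connection is half the Koszul expression, which consists of first
  derivatives of a C^2 metric. The index is raised again by
  \<open>differentiable_if_gram_differentiable\<close>, without a formula for the inverse
  matrix.\<close>

lemma levi_civita_differentiable:
  assumes x: "x \<in> U"
  shows "(\<lambda>y. levi_civita \<gamma> y v w) differentiable (at x)"
proof (rule differentiable_if_gram_differentiable[OF x])
  have "gram \<gamma> y (levi_civita \<gamma> y v w) = (\<Sum>b\<in>Basis. (koszul \<gamma> y v w b / 2) *\<^sub>R b)" if "y \<in> U" for y
    unfolding gram_def levi_civita_koszul[OF that, symmetric] by simp
  moreover have "(\<lambda>y. \<Sum>b\<in>Basis. (koszul \<gamma> y v w b / 2) *\<^sub>R b) differentiable (at x)"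
    unfolding koszul_def divide_inverse
    by (intro differentiable_sum ballI differentiable_scaleR differentiable_mult differentiable_diff
        differentiable_add differentiable_const metric_ddir_differentiable[OF x]) auto
  ultimately show "(\<lambda>y. gram \<gamma> y (levi_civita \<gamma> y v w)) differentiable (at x)"
    using differentiable_cong_open[OF metric_open x, of "\<lambda>y. gram \<gamma> y (levi_civita \<gamma> y v w)"
        "\<lambda>y. \<Sum>b\<in>Basis. (koszul \<gamma> y v w b / 2) *\<^sub>R b"] by simp
qed

end

definition ricci_of :: "('e::euclidean_space \<Rightarrow> 'e \<Rightarrow> 'e \<Rightarrow> real) \<Rightarrow> 'e \<Rightarrow> 'e \<Rightarrow> 'e \<Rightarrow> real" where
  "ricci_of \<gamma> x w z = (\<Sum>b\<in>Basis.
     (ddir (\<lambda>y. levi_civita \<gamma> y w z) b x - ddir (\<lambda>y. levi_civita \<gamma> y b z) w x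
      + levi_civita \<gamma> x b (levi_civita \<gamma> x w z) - levi_civita \<gamma> x w (levi_civita \<gamma> x b z)) \<bullet> b)"

lemma ricci_eq_ricci_of: "ricci M g C = ricci_of (metric_coeff M g C)"
  by (intro ext) (simp add: ricci_def riemann_def ricci_of_def christoffel_eq_levi_civita)

section \<open>Warped products in coordinates\<close>

lemma has_derivative_compose_fst:
  assumes "u differentiable (at x)"
  shows "((\<lambda>z. u (fst z)) has_derivative (\<lambda>v. ddir u (fst v) x)) (at (x, y))"
  using ddir_compose_linear[OF bounded_linear_fst, of u "(x, y)"] assms by simp

lemma has_derivative_compose_snd:
  assumes "u differentiable (at y)"
  shows "((\<lambda>z. u (snd z)) has_derivative (\<lambda>v. ddir u (snd v) y)) (at (x, y))"
  using ddir_compose_linear[OF bounded_linear_snd, of u "(x, y)"] assms by simp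

lemma has_derivative_partial_fst:
  assumes "u differentiable (at (x, y))"
  shows "((\<lambda>x. u (x, y)) has_derivative (\<lambda>v. ddir u (v, 0) (x, y))) (at x)"
proof -
  have "((\<lambda>x. (x, y)) has_derivative (\<lambda>v. (v, 0))) (at x)"
    by (intro has_derivative_Pair has_derivative_ident has_derivative_const)
  from has_derivative_compose[OF this] assms show ?thesis
    by (simp add: frechet_derivative_works)
qed

lemma has_derivative_partial_snd:
  assumes "u differentiable (at (x, y))"
  shows "((\<lambda>y. u (x, y)) has_derivative (\<lambda>v. ddir u (0, v) (x, y))) (at y)"
proof -
  have "((\<lambda>y. (x, y)) has_derivative (\<lambda>v. (0, v))) (at y)"
    by (intro has_derivative_Pair has_derivative_ident has_derivative_const)
  from has_derivative_compose[OF this] assms show ?thesis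
    by (simp add: frechet_derivative_works)
qed

text \<open>The index of the differential is raised with the semi-Riemannian metric, not with the
  Euclidean inner product.\<close>

definition gradient :: "('e::euclidean_space \<Rightarrow> 'e \<Rightarrow> 'e \<Rightarrow> real) \<Rightarrow> ('e \<Rightarrow> real) \<Rightarrow> 'e \<Rightarrow> 'e" where
  "gradient \<gamma> \<phi> x = (SOME z. \<forall>u. \<gamma> x z u = ddir \<phi> u x)"

lemma gradient:
  assumes "metric_on U \<gamma>" "x \<in> U" "\<phi> differentiable (at x)"
  shows "\<gamma> x (gradient \<gamma> \<phi> x) u = ddir \<phi> u x"
proof -
  obtain z where "\<And>u. \<gamma> x z u = ddir \<phi> u x"
    using metric_representation[OF assms(1,2) linear_frechet_derivative[OF assms(3)]] by blast
  then have "\<exists>z. \<forall>u. \<gamma> x z u = ddir \<phi> u x" by blast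
  from someI_ex[OF this] show ?thesis by (simp add: gradient_def)
qed

text \<open>Same device as for the connection: with lowered index the gradient is the vector of
  partial derivatives of \<open>\<phi>\<close>.\<close>

lemma gradient_differentiable:
  assumes "metric_on U \<gamma>" "x \<in> U" "Ck_on 2 U \<phi>"
  shows "gradient \<gamma> \<phi> differentiable (at x)"
proof (rule differentiable_if_gram_differentiable[OF assms(1,2)])
  have "gram \<gamma> y (gradient \<gamma> \<phi> y) = (\<Sum>b\<in>Basis. ddir \<phi> b y *\<^sub>R b)" if "y \<in> U" for y
    using gradient[OF assms(1) that Ck_on_2D(1)[OF assms(3) that]] by (simp add: gram_def)
  moreover have "(\<lambda>y. \<Sum>b\<in>Basis. ddir \<phi> b y *\<^sub>R b) differentiable (at x)"
    by (intro differentiable_sum ballI differentiable_scaleR differentiable_const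
        Ck_on_2D(2)[OF assms(3,2)]) auto
  ultimately show "(\<lambda>y. gram \<gamma> y (gradient \<gamma> \<phi> y)) differentiable (at x)"
    using differentiable_cong_open[OF metric_open[OF assms(1)] assms(2), of "\<lambda>y. gram \<gamma> y (gradient \<gamma> \<phi> y)"
        "\<lambda>y. \<Sum>b\<in>Basis. ddir \<phi> b y *\<^sub>R b"] by simp
qed

text \<open>The local model of a product chart. G is constrained on \<open>U \<times> V\<close>
  alone, because the metric coefficients of a chart carry no information outside its image.\<close>

locale warped =
  fixes U :: "'a::euclidean_space set" and \<gamma> :: "'a \<Rightarrow> 'a \<Rightarrow> 'a \<Rightarrow> real"
    and V :: "'c::euclidean_space set" and \<delta> :: "'c \<Rightarrow> 'c \<Rightarrow> 'c \<Rightarrow> real"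
    and \<phi> :: "'a \<Rightarrow> real" and G :: "'a \<times> 'c \<Rightarrow> 'a \<times> 'c \<Rightarrow> 'a \<times> 'c \<Rightarrow> real"
  assumes base: "metric_on U \<gamma>" and fiber: "metric_on V \<delta>"
    and \<phi>_C2: "Ck_on 2 U \<phi>" and \<phi>_pos: "x \<in> U \<Longrightarrow> \<phi> x > 0"
    and G_eq: "x \<in> U \<Longrightarrow> y \<in> V \<Longrightarrow>
      G (x, y) v w = \<gamma> x (fst v) (fst w) + (\<phi> x)\<^sup>2 * \<delta> y (snd v) (snd w)"
begin

lemma open_UV: "open (U \<times> V)"
  using metric_open[OF base] metric_open[OF fiber] by (rule open_Times)

lemmas \<phi>_differentiable = Ck_on_2D(1)[OF \<phi>_C2]

lemma ddir_G:
  assumes "x \<in> U" "y \<in> V"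
  shows "ddir (\<lambda>z. G z v w) u (x, y) =
    ddir (\<lambda>x. \<gamma> x (fst v) (fst w)) (fst u) x
    + 2 * \<phi> x * ddir \<phi> (fst u) x * \<delta> y (snd v) (snd w)
    + (\<phi> x)\<^sup>2 * ddir (\<lambda>y. \<delta> y (snd v) (snd w)) (snd u) y"
proof (rule ddir_eqI[OF open_UV])
  show "(x, y) \<in> U \<times> V" using assms by simp
  show "G z v w = \<gamma> (fst z) (fst v) (fst w) + \<phi> (fst z) * \<phi> (fst z) * \<delta> (snd z) (snd v) (snd w)"
    if "z \<in> U \<times> V" for z
    using that by (auto simp: G_eq power2_eq_square)
  have "((\<lambda>z. \<gamma> (fst z) (fst v) (fst w) + \<phi> (fst z) * \<phi> (fst z) * \<delta> (snd z) (snd v) (snd w))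
    has_derivative (\<lambda>u. ddir (\<lambda>x. \<gamma> x (fst v) (fst w)) (fst u) x
      + (\<phi> (fst (x, y)) * \<phi> (fst (x, y)) * ddir (\<lambda>y. \<delta> y (snd v) (snd w)) (snd u) y
      + (\<phi> (fst (x, y)) * ddir \<phi> (fst u) x + ddir \<phi> (fst u) x * \<phi> (fst (x, y)))
        * \<delta> (snd (x, y)) (snd v) (snd w))))
    (at (x, y))"
    by (intro has_derivative_add has_derivative_mult has_derivative_compose_fst
        has_derivative_compose_snd \<phi>_differentiable
        metric_differentiable[OF base] metric_differentiable[OF fiber] assms)
  then show "((\<lambda>z. \<gamma> (fst z) (fst v) (fst w) + \<phi> (fst z) * \<phi> (fst z) * \<delta> (snd z) (snd v) (snd w))
    has_derivative (\<lambda>u. ddir (\<lambda>x. \<gamma> x (fst v) (fst w)) (fst u) x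
    + 2 * \<phi> x * ddir \<phi> (fst u) x * \<delta> y (snd v) (snd w)
    + (\<phi> x)\<^sup>2 * ddir (\<lambda>y. \<delta> y (snd v) (snd w)) (snd u) y)) (at (x, y))"
    by (simp add: algebra_simps power2_eq_square)
qed

text \<open>The differential of the logarithm of the warping function. It is the mixed connection
  coefficient: nabla_X V = (X f / f) V for X horizontal and V vertical.\<close>

definition dlog :: "'a \<Rightarrow> 'a \<Rightarrow> real" where "dlog a x = ddir \<phi> a x / \<phi> x"

lemma dlog_differentiable: "x \<in> U \<Longrightarrow> dlog a differentiable (at x)"
  unfolding dlog_def[abs_def]
  using Ck_on_2D[OF \<phi>_C2] \<phi>_pos[of x] by (intro differentiable_divide) auto

lemma dlog_zero: "x \<in> U \<Longrightarrow> dlog 0 x = 0"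
  using linear_0[OF linear_frechet_derivative[OF \<phi>_differentiable]] by (simp add: dlog_def)

lemma G_bilinear:
  assumes "x \<in> U" "y \<in> V"
  shows "bilinear (G (x, y))"
proof -
  have b: "bilinear (\<gamma> x)" "bilinear (\<delta> y)"
    using metric_bilinear[OF base] metric_bilinear[OF fiber] assms by auto
  show ?thesis
    unfolding bilinear_def
    by (auto intro!: linearI simp: G_eq[OF assms] bilinear_ladd[OF b(1)] bilinear_ladd[OF b(2)]
        bilinear_radd[OF b(1)] bilinear_radd[OF b(2)] bilinear_lmul[OF b(1)] bilinear_lmul[OF b(2)]
        bilinear_rmul[OF b(1)] bilinear_rmul[OF b(2)] algebra_simps)
qed

lemma G_nondegenerate:
  assumes "x \<in> U" "y \<in> V" and G: "\<And>w. G (x, y) v w = 0"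
  shows "v = 0"
proof -
  have "fst v = 0"
  proof (rule metric_nondegenerate[OF base assms(1)])
    fix w show "\<gamma> x (fst v) w = 0"
      using G[of "(w, 0)"] bilinear_rzero[OF metric_bilinear[OF fiber assms(2)]]
      by (simp add: G_eq[OF assms(1,2)])
  qed
  moreover have "snd v = 0"
  proof (rule metric_nondegenerate[OF fiber assms(2)])
    fix w show "\<delta> y (snd v) w = 0"
      using G[of "(0, w)"] bilinear_rzero[OF metric_bilinear[OF base assms(1)]] \<phi>_pos[OF assms(1)]
      by (simp add: G_eq[OF assms(1,2)])
  qed
  ultimately show ?thesis by (simp add: prod_eq_iff)
qed

text \<open>O'Neill's connection formulas in one expression, checked against the Koszul formula. The
  correction terms come from differentiating the factor \<open>\<phi>\<close> squared: along the
  test vector u this gives the gradient term, along v and w the two \<open>dlog\<close>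
  terms.\<close>

lemma levi_civita_warped:
  assumes x: "x \<in> U" and y: "y \<in> V"
  shows "levi_civita G (x, y) v w =
    (levi_civita \<gamma> x (fst v) (fst w) - (\<phi> x * \<delta> y (snd v) (snd w)) *\<^sub>R gradient \<gamma> \<phi> x,
     levi_civita \<delta> y (snd v) (snd w) + dlog (fst v) x *\<^sub>R snd w + dlog (fst w) x *\<^sub>R snd v)"
proof (rule levi_civita_unique[where \<gamma> = G, OF G_bilinear[OF x y]])
  show "v = 0" if "\<And>w. G (x, y) v w = 0" for v
    using G_nondegenerate[OF x y that] .
next
  fix u
  note b = metric_bilinear[OF base x]
  note d = metric_bilinear[OF fiber y]
  have pos: "\<phi> x \<noteq> 0" using \<phi>_pos[OF x] by simp
  have "2 * G (x, y) (levi_civita \<gamma> x (fst v) (fst w) - (\<phi> x * \<delta> y (snd v) (snd w)) *\<^sub>R gradient \<gamma> \<phi> x,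
     levi_civita \<delta> y (snd v) (snd w) + dlog (fst v) x *\<^sub>R snd w + dlog (fst w) x *\<^sub>R snd v) u
    = 2 * \<gamma> x (levi_civita \<gamma> x (fst v) (fst w)) (fst u)
      - 2 * \<phi> x * \<delta> y (snd v) (snd w) * ddir \<phi> (fst u) x
      + (\<phi> x)\<^sup>2 * (2 * \<delta> y (levi_civita \<delta> y (snd v) (snd w)) (snd u))
      + 2 * (\<phi> x)\<^sup>2 * dlog (fst v) x * \<delta> y (snd w) (snd u)
      + 2 * (\<phi> x)\<^sup>2 * dlog (fst w) x * \<delta> y (snd v) (snd u)"
    by (simp add: G_eq[OF x y] bilinear_lsub[OF b] bilinear_lmul[OF b] bilinear_ladd[OF d]
        bilinear_lmul[OF d] gradient[OF base x \<phi>_differentiable[OF x]] algebra_simps)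
  also have "\<dots> = koszul \<gamma> x (fst v) (fst w) (fst u)
      - 2 * \<phi> x * \<delta> y (snd v) (snd w) * ddir \<phi> (fst u) x
      + (\<phi> x)\<^sup>2 * koszul \<delta> y (snd v) (snd w) (snd u)
      + 2 * \<phi> x * ddir \<phi> (fst v) x * \<delta> y (snd w) (snd u)
      + 2 * \<phi> x * ddir \<phi> (fst w) x * \<delta> y (snd v) (snd u)"
    using pos unfolding levi_civita_koszul[OF base x] levi_civita_koszul[OF fiber y]
    by (simp add: dlog_def power2_eq_square)
  also have "\<dots> = koszul G (x, y) v w u"
    by (simp add: koszul_def ddir_G[OF x y] algebra_simps)
  finally show "2 * G (x, y) (levi_civita \<gamma> x (fst v) (fst w) - (\<phi> x * \<delta> y (snd v) (snd w)) *\<^sub>R gradient \<gamma> \<phi> x,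
     levi_civita \<delta> y (snd v) (snd w) + dlog (fst v) x *\<^sub>R snd w + dlog (fst w) x *\<^sub>R snd v) u
    = koszul G (x, y) v w u" .
qed

lemma levi_civita_cases:
  assumes x: "x \<in> U" and y: "y \<in> V"
  shows "levi_civita G (x, y) (a, 0) (c, 0) = (levi_civita \<gamma> x a c, 0)"
    and "levi_civita G (x, y) (a, 0) (0, d) = (0, dlog a x *\<^sub>R d)"
    and "levi_civita G (x, y) (0, d) (a, 0) = (0, dlog a x *\<^sub>R d)"
    and "levi_civita G (x, y) (0, d) (0, e) =
      (- (\<phi> x * \<delta> y d e) *\<^sub>R gradient \<gamma> \<phi> x, levi_civita \<delta> y d e)"
  using bilinear_lzero[OF metric_bilinear[OF fiber y]] bilinear_rzero[OF metric_bilinear[OF fiber y]]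
  by (simp_all add: levi_civita_warped[OF x y] levi_civita_zero[OF base x]
      levi_civita_zero[OF fiber y] dlog_zero[OF x])

text \<open>For two vertical vectors the fiber component is enough, since in the mixed Ricci trace
  this derivative is paired with vertical basis vectors.\<close>

lemma ddir_levi_civita_cases:
  assumes x: "x \<in> U" and y: "y \<in> V"
  shows "ddir (\<lambda>z. levi_civita G z (a, 0) (c, 0)) u (x, y)
      = (ddir (\<lambda>x. levi_civita \<gamma> x a c) (fst u) x, 0)"
    and "ddir (\<lambda>z. levi_civita G z (a, 0) (0, d)) u (x, y) = (0, ddir (dlog a) (fst u) x *\<^sub>R d)"
    and "ddir (\<lambda>z. levi_civita G z (0, d) (a, 0)) u (x, y) = (0, ddir (dlog a) (fst u) x *\<^sub>R d)"
    and "snd (ddir (\<lambda>z. levi_civita G z (0, d) (0, e)) u (x, y))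
      = ddir (\<lambda>y. levi_civita \<delta> y d e) (snd u) y"
proof -
  have xy: "(x, y) \<in> U \<times> V" using x y by simp
  note D = levi_civita_differentiable[OF base x] levi_civita_differentiable[OF fiber y]
    dlog_differentiable[OF x] \<phi>_differentiable[OF x] metric_differentiable[OF fiber y]
    gradient_differentiable[OF base x \<phi>_C2]
  have "((\<lambda>z. (levi_civita \<gamma> (fst z) a c, 0)) has_derivative
      (\<lambda>u. (ddir (\<lambda>x. levi_civita \<gamma> x a c) (fst u) x, 0))) (at (x, y))"
    by (intro has_derivative_Pair has_derivative_const has_derivative_compose_fst D)
  then show "ddir (\<lambda>z. levi_civita G z (a, 0) (c, 0)) u (x, y)
      = (ddir (\<lambda>x. levi_civita \<gamma> x a c) (fst u) x, 0)"
    by (rule ddir_eqI[OF open_UV xy, rotated]) (auto simp: levi_civita_cases)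
  have mixed: "((\<lambda>z. (0, dlog a (fst z) *\<^sub>R d)) has_derivative
      (\<lambda>u. (0, ddir (dlog a) (fst u) x *\<^sub>R d))) (at (x, y))"
    by (intro has_derivative_Pair has_derivative_const has_derivative_scaleR_left
        has_derivative_compose_fst D)
  show "ddir (\<lambda>z. levi_civita G z (a, 0) (0, d)) u (x, y) = (0, ddir (dlog a) (fst u) x *\<^sub>R d)"
    by (rule ddir_eqI[OF open_UV xy _ mixed]) (auto simp: levi_civita_cases)
  show "ddir (\<lambda>z. levi_civita G z (0, d) (a, 0)) u (x, y) = (0, ddir (dlog a) (fst u) x *\<^sub>R d)"
    by (rule ddir_eqI[OF open_UV xy _ mixed]) (auto simp: levi_civita_cases)
  \<comment> \<open>Some derivative T of the base component must exist for the pair to be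
    differentiable; its value is irrelevant to the fiber component.\<close>
  have "(\<lambda>z. \<phi> (fst z)) differentiable (at (x, y))"
      "(\<lambda>z. \<delta> (snd z) d e) differentiable (at (x, y))"
      "(\<lambda>z. gradient \<gamma> \<phi> (fst z)) differentiable (at (x, y))"
    by (rule differentiableI, rule has_derivative_compose_fst has_derivative_compose_snd, rule D)+
  then have "(\<lambda>z. - (\<phi> (fst z) * \<delta> (snd z) d e) *\<^sub>R gradient \<gamma> \<phi> (fst z)) differentiable (at (x, y))"
    by (intro differentiable_scaleR differentiable_minus differentiable_mult)
  then obtain T where T: "((\<lambda>z. - (\<phi> (fst z) * \<delta> (snd z) d e) *\<^sub>R gradient \<gamma> \<phi> (fst z)) has_derivative T) (at (x, y))"
    by (auto simp: differentiable_def)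
  have "((\<lambda>z. (- (\<phi> (fst z) * \<delta> (snd z) d e) *\<^sub>R gradient \<gamma> \<phi> (fst z), levi_civita \<delta> (snd z) d e)) has_derivative
      (\<lambda>u. (T u, ddir (\<lambda>y. levi_civita \<delta> y d e) (snd u) y))) (at (x, y))"
    by (intro has_derivative_Pair has_derivative_compose_snd D T)
  then have "ddir (\<lambda>z. levi_civita G z (0, d) (0, e)) u (x, y)
      = (T u, ddir (\<lambda>y. levi_civita \<delta> y d e) (snd u) y)"
    by (rule ddir_eqI[OF open_UV xy, rotated]) (auto simp: levi_civita_cases)
  then show "snd (ddir (\<lambda>z. levi_civita G z (0, d) (0, e)) u (x, y))
      = ddir (\<lambda>y. levi_civita \<delta> y d e) (snd u) y"
    by simp
qed

section \<open>The Ricci tensor of a warped product\<close>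

lemma trace_prod_eq:
  fixes R :: "('a \<times> 'c \<Rightarrow> 'a \<times> 'c)"
  shows "(\<Sum>b\<in>Basis. R b \<bullet> b) = (\<Sum>b\<in>Basis. fst (R (b, 0)) \<bullet> b) + (\<Sum>b\<in>Basis. snd (R (0, b)) \<bullet> b)"
  unfolding Basis_prod_def
  by (subst sum.union_disjoint) (auto simp: sum.reindex inj_on_def inner_prod_def[of "R _"])

text \<open>In the horizontal part of the trace every term is a vertical vector and has base
  component 0. In the vertical part both derivatives vanish, as \<open>dlog\<close> is constant
  along the fiber and the fiber connection along the base; the two quadratic terms are both
  \<open>dlog a x\<close> times the fiber connection of b and d, with opposite signs.\<close>

lemma ricci_mixed:
  assumes x: "x \<in> U" and y: "y \<in> V"
  shows "ricci_of G (x, y) (a, 0) (0, d) = 0"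
proof -
  \<comment> \<open>The last curvature term applies the connection to the derivative of one vertical
    vector along another, which has a gradient part as well as a fiber part.\<close>
  have "levi_civita G (x, y) (a, 0) (s, t) = (levi_civita \<gamma> x a s, dlog a x *\<^sub>R t)" for s t
    using bilinear_lzero[OF metric_bilinear[OF fiber y]]
    by (simp add: levi_civita_warped[OF x y] levi_civita_zero[OF fiber y])
  then show ?thesis
    unfolding ricci_of_def trace_prod_eq
    by (simp add: ddir_levi_civita_cases[OF x y] levi_civita_cases[OF x y] levi_civita_scaleR[OF fiber y]
        levi_civita_zero[OF base x]
        linear_0[OF linear_frechet_derivative[OF dlog_differentiable[OF x]]]
        linear_0[OF linear_frechet_derivative[OF levi_civita_differentiable[OF fiber y]]])
qed

text \<open>Two vertical vectors never meet in this trace. The remaining connection formulas have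
  coefficients that are functions of x alone.\<close>

lemma ricci_horizontal:
  assumes x: "x \<in> U" and y: "y \<in> V" "y' \<in> V"
  shows "ricci_of G (x, y) (a, 0) (c, 0) = ricci_of G (x, y') (a, 0) (c, 0)"
  unfolding ricci_of_def trace_prod_eq
  by (simp add: ddir_levi_civita_cases[OF x y(1)] levi_civita_cases[OF x y(1)]
        ddir_levi_civita_cases[OF x y(2)] levi_civita_cases[OF x y(2)])

section \<open>The potential of a soliton in a product chart\<close>

lemma potential_difference_proportional:
  assumes H: "Ck_on 2 (U \<times> V) H"
    and mixed: "\<And>x y a d. x \<in> U \<Longrightarrow> y \<in> V \<Longrightarrow>
      ddir (\<lambda>z. ddir H (0, d) z) (a, 0) (x, y) = ddir H (0, dlog a x *\<^sub>R d) (x, y)"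
    and X: "convex X" "open X" "X \<subseteq> U" "x0 \<in> X" and Y: "convex Y" "open Y" "Y \<subseteq> V"
    and x: "x \<in> X" and y: "y \<in> Y" "y' \<in> Y"
  shows "(H (x, y) - H (x, y')) / \<phi> x = (H (x0, y) - H (x0, y')) / \<phi> x0"
proof -
  have diff: "H differentiable (at (x, y))" "ddir H v differentiable (at (x, y))"
    if "x \<in> X" "y \<in> Y" for x y v
    using that X Y by (auto intro!: Ck_on_2D[OF H])
  \<comment> \<open>The mixed equation says exactly that the numerator of the quotient rule
    vanishes; on the convex set X a zero derivative forces constancy.\<close>
  have quot: "ddir H (0, d) (x, y) / \<phi> x = ddir H (0, d) (x0, y) / \<phi> x0" if y: "y \<in> Y" for y d
  proof -
    have "((\<lambda>x. ddir H (0, d) (x, y) / \<phi> x) has_derivative (\<lambda>a. 0)) (at x within X)" if x: "x \<in> X" for x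
    proof -
      have pos: "\<phi> x \<noteq> 0" using \<phi>_pos[of x] x X by auto
      have "((\<lambda>x. ddir H (0, d) (x, y) / \<phi> x) has_derivative
        (\<lambda>a. (ddir (ddir H (0, d)) (a, 0) (x, y) * \<phi> x - ddir H (0, d) (x, y) * ddir \<phi> a x) / (\<phi> x * \<phi> x)))
        (at x)"
        using pos x y X diff \<phi>_differentiable
        by (intro has_derivative_divide' has_derivative_partial_fst)
          (auto simp: frechet_derivative_works[symmetric])
      moreover have "ddir (ddir H (0, d)) (a, 0) (x, y) * \<phi> x - ddir H (0, d) (x, y) * ddir \<phi> a x = 0" for a
      proof -
        have "(0, dlog a x *\<^sub>R d) = dlog a x *\<^sub>R (0, d)" by simp
        then have "ddir H (0, dlog a x *\<^sub>R d) (x, y) = dlog a x * ddir H (0, d) (x, y)"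
          using linear_cmul[OF linear_frechet_derivative[OF diff(1)[OF x y]]]
          by (metis real_scaleR_def)
        moreover have "ddir (ddir H (0, d)) (a, 0) (x, y) = ddir H (0, dlog a x *\<^sub>R d) (x, y)"
          using mixed[of x y d a] x y X Y by auto
        ultimately show ?thesis
          using pos by (simp add: dlog_def)
      qed
      ultimately show ?thesis
        by (simp add: has_derivative_at_withinI)
    qed
    from has_derivative_zero_unique[OF X(1) this x X(4)] show ?thesis by simp
  qed
  \<comment> \<open>Second integration, now in the fiber: by \<open>quot\<close> this function of y
    has zero derivative, so its values at y and y' coincide.\<close>
  have "((\<lambda>y. H (x, y) / \<phi> x - H (x0, y) / \<phi> x0) has_derivative (\<lambda>d. 0)) (at y within Y)" if y: "y \<in> Y" for y
  proof -
    have "((\<lambda>y. H (x, y) / \<phi> x - H (x0, y) / \<phi> x0) has_derivative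
        (\<lambda>d. ddir H (0, d) (x, y) / \<phi> x - ddir H (0, d) (x0, y) / \<phi> x0)) (at y)"
      unfolding divide_inverse using x y X diff
      by (intro has_derivative_diff has_derivative_mult_left has_derivative_partial_snd) auto
    then show ?thesis
      by (simp add: quot[OF y] has_derivative_at_withinI)
  qed
  from has_derivative_zero_unique[OF Y(1) this y]
  show ?thesis by (simp add: diff_divide_distrib)
qed

text \<open>On horizontal pairs the metric, the Ricci tensor and the connection are the same at y
  and y'. Subtracting the two soliton equations leaves only the base Hessian of the difference
  u.\<close>

lemma hessian_zero_if_soliton:
  assumes H: "Ck_on 2 (U \<times> V) H"
    and soliton: "\<And>x y v w. x \<in> U \<Longrightarrow> y \<in> V \<Longrightarrow>
      ricci_of G (x, y) v w + (ddir (\<lambda>z. ddir H w z) v (x, y) - ddir H (levi_civita G (x, y) v w) (x, y))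
        = \<rho> * G (x, y) v w"
    and y: "y \<in> V" "y' \<in> V" and x: "x \<in> U"
  defines "u \<equiv> \<lambda>x. H (x, y) - H (x, y')"
  shows "ddir (\<lambda>x. ddir u c x) a x - ddir u (levi_civita \<gamma> x a c) x = 0"
proof -
  have diff: "H differentiable (at (x, y))" "ddir H v differentiable (at (x, y))"
    if "x \<in> U" "y \<in> V" for x y v
    using that by (auto intro!: Ck_on_2D[OF H])
  have u: "ddir u c x = ddir H (c, 0) (x, y) - ddir H (c, 0) (x, y')" if "x \<in> U" for c x
  proof -
    have "(u has_derivative (\<lambda>c. ddir H (c, 0) (x, y) - ddir H (c, 0) (x, y'))) (at x)"
      unfolding u_def using that y diff
      by (intro has_derivative_diff has_derivative_partial_fst) auto
    from frechet_derivative_at[OF this] show ?thesis by metis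
  qed
  have uu: "ddir (\<lambda>x. ddir u c x) a x
      = ddir (ddir H (c, 0)) (a, 0) (x, y) - ddir (ddir H (c, 0)) (a, 0) (x, y')"
    using x y diff
    by (intro ddir_eqI[OF metric_open[OF base] _ u] has_derivative_diff has_derivative_partial_fst) auto
  have zero: "\<delta> y 0 0 = 0" if "y \<in> V" for y
    using bilinear_lzero[OF metric_bilinear[OF fiber that]] .
  have "ricci_of G (x, y) (a, 0) (c, 0) = ricci_of G (x, y') (a, 0) (c, 0)"
    by (rule ricci_horizontal[OF x y])
  moreover have "G (x, y) (a, 0) (c, 0) = G (x, y') (a, 0) (c, 0)"
    using x y zero by (simp add: G_eq)
  ultimately show ?thesis
    using soliton[OF x y(1), of "(a, 0)" "(c, 0)"] soliton[OF x y(2), of "(a, 0)" "(c, 0)"]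
    by (simp add: uu u[OF x] levi_civita_cases(1)[OF x y(1)] levi_civita_cases(1)[OF x y(2)])
qed

text \<open>Metric and Ricci tensor vanish on the pair (a, 0), (0, d), so the equation reduces to a
  vanishing Hessian, whose connection term is the \<open>dlog\<close> one.\<close>

lemma potential_mixed_if_soliton:
  assumes soliton: "\<And>x y v w. x \<in> U \<Longrightarrow> y \<in> V \<Longrightarrow>
      ricci_of G (x, y) v w + (ddir (\<lambda>z. ddir H w z) v (x, y) - ddir H (levi_civita G (x, y) v w) (x, y))
        = \<rho> * G (x, y) v w"
    and x: "x \<in> U" and y: "y \<in> V"
  shows "ddir (\<lambda>z. ddir H (0, d) z) (a, 0) (x, y) = ddir H (0, dlog a x *\<^sub>R d) (x, y)"
proof -
  have "\<gamma> x a 0 = 0" "\<delta> y 0 d = 0"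
    using bilinear_rzero[OF metric_bilinear[OF base x]] bilinear_lzero[OF metric_bilinear[OF fiber y]] by auto
  then show ?thesis
    using soliton[OF x y, of "(a, 0)" "(0, d)"]
    by (simp add: ricci_mixed[OF x y] levi_civita_cases[OF x y] G_eq[OF x y])
qed

lemma potential_eq_if_hessian_nonzero:
  assumes H: "Ck_on 2 (U \<times> V) H"
    and soliton: "\<And>x y v w. x \<in> U \<Longrightarrow> y \<in> V \<Longrightarrow>
      ricci_of G (x, y) v w + (ddir (\<lambda>z. ddir H w z) v (x, y) - ddir H (levi_civita G (x, y) v w) (x, y))
        = \<rho> * G (x, y) v w"
    and x: "x0 \<in> U" and Y: "convex Y" "open Y" "Y \<subseteq> V" and y: "y \<in> Y" "y' \<in> Y"
    and hess: "ddir (\<lambda>x. ddir \<phi> c x) a x0 - ddir \<phi> (levi_civita \<gamma> x0 a c) x0 \<noteq> 0"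
  shows "H (x0, y) = H (x0, y')"
proof -
  obtain r where r: "r > 0" "ball x0 r \<subseteq> U"
    using metric_open[OF base] x openE by blast
  define X where "X = ball x0 r"
  have X: "convex X" "open X" "X \<subseteq> U" "x0 \<in> X"
    using r by (auto simp: X_def)
  define u where "u = (\<lambda>x. H (x, y) - H (x, y'))"
  \<comment> \<open>The factor in \<open>u x = K * \<phi> x\<close> is forced by evaluation at x0.
    Since u and \<open>K * \<phi>\<close> agree on a neighbourhood, their second derivatives at x0
    agree too.\<close>
  define K where "K = u x0 / \<phi> x0"
  have u: "u x = K * \<phi> x" if "x \<in> X" for x
    using potential_difference_proportional[OF H potential_mixed_if_soliton[OF soliton] X Y that y]
      \<phi>_pos[of x] that X by (auto simp: u_def K_def field_simps)
  have du: "ddir u c x = K * ddir \<phi> c x" if "x \<in> X" for c x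
    using that X \<phi>_differentiable
    by (intro ddir_eqI[OF X(2) _ u] has_derivative_mult_right) (auto simp: frechet_derivative_works[symmetric])
  have "ddir (\<lambda>x. ddir u c x) a x0 = K * ddir (ddir \<phi> c) a x0"
    using X Ck_on_2D(2)[OF \<phi>_C2]
    by (intro ddir_eqI[OF X(2) _ du] has_derivative_mult_right) (auto simp: frechet_derivative_works[symmetric])
  moreover have "ddir (\<lambda>x. ddir u c x) a x0 - ddir u (levi_civita \<gamma> x0 a c) x0 = 0"
    unfolding u_def using Y y by (intro hessian_zero_if_soliton[OF H soliton _ _ x]) auto
  ultimately have "K * (ddir (\<lambda>x. ddir \<phi> c x) a x0 - ddir \<phi> (levi_civita \<gamma> x0 a c) x0) = 0"
    using du[OF X(4)] by (simp add: algebra_simps)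
  then have "K = 0" using hess by simp
  then show ?thesis
    using u[OF X(4)] by (simp add: u_def)
qed

end

section \<open>Charts\<close>

lemma locally_constant_imp_constant:
  assumes "connected_space X"
    and loc: "\<And>x. x \<in> topspace X \<Longrightarrow> \<exists>W. openin X W \<and> x \<in> W \<and> (\<forall>y\<in>W. R y = R x)"
    and xy: "x \<in> topspace X" "y \<in> topspace X"
  shows "R x = R y"
proof -
  \<comment> \<open>An arbitrary predicate on the values covers both the level set of x and its
    complement, so the level set is clopen.\<close>
  have op: "openin X {z \<in> topspace X. P (R z)}" for P
  proof (subst openin_subopen, rule ballI)
    fix z assume z: "z \<in> {z \<in> topspace X. P (R z)}"
    then have "z \<in> topspace X" by simp
    from loc[OF this] obtain W where "openin X W \<and> z \<in> W \<and> (\<forall>y\<in>W. R y = R z)" ..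
    then have W: "openin X W" "z \<in> W" "\<forall>y\<in>W. R y = R z" by blast+
    have "W \<subseteq> {z \<in> topspace X. P (R z)}"
    proof
      fix y assume y: "y \<in> W"
      have "R y = R z" by (rule bspec[OF W(3) y])
      then show "y \<in> {z \<in> topspace X. P (R z)}"
        using z openin_subset[OF W(1)] y by auto
    qed
    with W show "\<exists>W. openin X W \<and> z \<in> W \<and> W \<subseteq> {z \<in> topspace X. P (R z)}"
      by blast
  qed
  define S where "S = {z \<in> topspace X. R z = R x}"
  have "topspace X - S = {z \<in> topspace X. R z \<noteq> R x}"
    by (auto simp: S_def)
  then have "closedin X S"
    using op[of "\<lambda>r. r \<noteq> R x"] by (auto simp: closedin_def S_def)
  moreover have "openin X S" "x \<in> S"
    unfolding S_def using op[of "\<lambda>r. r = R x"] xy by auto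
  ultimately have "S = topspace X"
    using assms(1) unfolding connected_space_clopen_in by blast
  with xy have "y \<in> S" by simp
  then show ?thesis by (simp add: S_def)
qed

context
  fixes M :: "('a, 'e::euclidean_space) mfd" and C
  assumes manifold: "smooth_manifold M" and C: "C \<in> atlas M"
begin

lemma chart_dom_open: "openin (mtop M) (chart_dom C)"
  and chart_img_open: "open (chart_img C)"
  and chart_homeomorphic:
    "homeomorphic_map (subtopology (mtop M) (chart_dom C)) (top_of_set (chart_img C)) (snd C)"
  and chart_transition: "D \<in> atlas M \<Longrightarrow>
    Cinf_on (snd C ` (chart_dom C \<inter> chart_dom D)) (snd D \<circ> chart_inv C)"
  using manifold C by (auto simp: smooth_manifold_def)

lemma chart_dom_subset: "chart_dom C \<subseteq> points M"
  using chart_dom_open by (rule openin_subset)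

lemma chart_inj: "inj_on (snd C) (chart_dom C)"
  using homeomorphic_imp_injective_map[OF chart_homeomorphic] chart_dom_subset
  by (simp add: Int_absorb1)

lemma chart_inv_chart: "p \<in> chart_dom C \<Longrightarrow> chart_inv C (snd C p) = p"
  using chart_inj by simp

lemma open_chart_image:
  assumes "openin (mtop M) W"
  shows "open (snd C ` (chart_dom C \<inter> W))"
proof -
  have "openin (subtopology (mtop M) (chart_dom C)) (chart_dom C \<inter> W)"
    using assms by (simp add: openin_subtopology_Int2)
  then have "openin (top_of_set (chart_img C)) (snd C ` (chart_dom C \<inter> W))"
    using homeomorphic_imp_open_map[OF chart_homeomorphic] by (simp add: open_map_def)
  then show ?thesis
    using openin_open_trans[OF _ chart_img_open] by blast
qed

lemma openin_chart_vimage: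
  assumes "open Y"
  shows "openin (mtop M) {p \<in> chart_dom C. snd C p \<in> Y}"
proof -
  have "continuous_map (subtopology (mtop M) (chart_dom C)) (top_of_set (chart_img C)) (snd C)"
    using homeomorphic_imp_continuous_map[OF chart_homeomorphic] .
  moreover have "openin (top_of_set (chart_img C)) (chart_img C \<inter> Y)"
    using assms by (simp add: openin_open_Int)
  ultimately have "openin (subtopology (mtop M) (chart_dom C))
      {p \<in> topspace (subtopology (mtop M) (chart_dom C)). snd C p \<in> chart_img C \<inter> Y}"
    by (rule openin_continuous_map_preimage)
  also have "{p \<in> topspace (subtopology (mtop M) (chart_dom C)). snd C p \<in> chart_img C \<inter> Y}
      = {p \<in> chart_dom C. snd C p \<in> Y}"
    using chart_dom_subset by auto
  finally show ?thesis
    using openin_trans_full chart_dom_open by blast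
qed

lemma smooth_fun_on_Ck_chart:
  assumes "smooth_fun_on M (points M) u"
  shows "Ck_on k (chart_img C) (u \<circ> chart_inv C)"
proof -
  have "Ck_on k (snd C ` (chart_dom C \<inter> points M)) (u \<circ> chart_inv C)"
    using assms C by (simp add: smooth_fun_on_def Cinf_on_def)
  then show ?thesis
    by (simp only: Int_absorb2[OF chart_dom_subset])
qed

section \<open>Tangent vectors in charts\<close>

lemma smooth_near_differentiable:
  assumes "smooth_near M p u" "p \<in> chart_dom C"
  shows "(u \<circ> chart_inv C) differentiable (at (snd C p))"
proof -
  obtain W where "p \<in> W" "smooth_fun_on M W u"
    using assms(1) by (auto simp: smooth_near_def)
  then have "Ck_on (Suc 0) (snd C ` (chart_dom C \<inter> W)) (u \<circ> chart_inv C)" "p \<in> W"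
    using C unfolding smooth_fun_on_def Cinf_on_def by blast+
  then show ?thesis using assms(2) by auto
qed

text \<open>On functions smooth near p this is linearity of the derivative; on all others both sides
  take the default value 0.\<close>

lemma coord_vec_linear:
  assumes p: "p \<in> chart_dom C"
  shows "coord_vec M C p (a *\<^sub>R v + b *\<^sub>R w) = (\<lambda>u. a * coord_vec M C p v u + b * coord_vec M C p w u)"
proof
  fix u
  show "coord_vec M C p (a *\<^sub>R v + b *\<^sub>R w) u = a * coord_vec M C p v u + b * coord_vec M C p w u"
    using linear_frechet_derivative[OF smooth_near_differentiable[OF _ p, of u]]
    by (auto simp: coord_vec_def linear_add linear_cmul)
qed

lemma coord_vec_in_tangent_space: "p \<in> chart_dom C \<Longrightarrow> coord_vec M C p v \<in> tangent_space M p"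
  unfolding tangent_space_def using C by blast

end

context
  fixes M :: "('a, 'e::euclidean_space) mfd" and C
  assumes manifold: "smooth_manifold M" and C: "C \<in> atlas M"
begin

text \<open>Seen in another chart, a coordinate function is a component of the transition map.
  Coordinates serve as test functions that recover v from \<open>coord_vec M C p v\<close>.\<close>

lemma smooth_near_coordinate:
  assumes p: "p \<in> chart_dom C"
  shows "smooth_near M p (\<lambda>q. snd C q \<bullet> b)"
  unfolding smooth_near_def smooth_fun_on_def
proof (intro exI conjI ballI)
  show "openin (mtop M) (chart_dom C)" using chart_dom_open[OF manifold C] .
  fix D assume D: "D \<in> atlas M"
  have "Ck_on k (snd D ` (chart_dom D \<inter> chart_dom C)) (\<lambda>x. (snd C \<circ> chart_inv D) x \<bullet> b)" for k
    using chart_transition[OF manifold D C] open_chart_image[OF manifold D chart_dom_open[OF manifold C]]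
    by (intro Ck_on_linear_compose[OF bounded_linear_inner_left]) (auto simp: Cinf_on_def comp_def)
  then show "Cinf_on (snd D ` (chart_dom D \<inter> chart_dom C)) ((\<lambda>q. snd C q \<bullet> b) \<circ> chart_inv D)"
    by (simp add: Cinf_on_def comp_def)
qed (rule p)

lemma coord_vec_coordinate:
  assumes p: "p \<in> chart_dom C"
  shows "coord_vec M C p v (\<lambda>q. snd C q \<bullet> b) = v \<bullet> b"
proof -
  have "ddir ((\<lambda>q. snd C q \<bullet> b) \<circ> chart_inv C) v (snd C p) = v \<bullet> b"
  proof (rule ddir_eqI[OF chart_img_open[OF manifold C]])
    show "((\<lambda>x. x \<bullet> b) has_derivative (\<lambda>v. v \<bullet> b)) (at (snd C p))"
      by (intro bounded_linear_imp_has_derivative bounded_linear_inner_left)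
  qed (use p in \<open>auto simp: f_inv_into_f\<close>)
  then show ?thesis
    using smooth_near_coordinate[OF p] by (simp add: coord_vec_def)
qed

lemma coord_vec_eq_zeroD:
  assumes p: "p \<in> chart_dom C" and "coord_vec M C p v = (\<lambda>u. 0)"
  shows "v = 0"
  using assms(2) coord_vec_coordinate[OF p] by (metis inner_eq_zero_iff)

text \<open>The chain rule for the transition map. It shows that the vectors of one chart already
  exhaust \<open>tangent_space M p\<close>, which is formed from all charts around p.\<close>

lemma coord_vec_change_chart:
  assumes D: "D \<in> atlas M" and p: "p \<in> chart_dom C" "p \<in> chart_dom D"
  shows "coord_vec M D p w = coord_vec M C p (ddir (snd C \<circ> chart_inv D) w (snd D p))"
proof
  fix u
  define T where "T = snd C \<circ> chart_inv D"
  define S where "S = snd D ` (chart_dom D \<inter> chart_dom C)"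
  have S: "open S" "snd D p \<in> S"
    unfolding S_def using open_chart_image[OF manifold D chart_dom_open[OF manifold C]] p by auto
  have "Ck_on 1 S T"
    using chart_transition[OF manifold D C] by (simp add: S_def T_def Cinf_on_def)
  then have T: "(T has_derivative frechet_derivative T (at (snd D p))) (at (snd D p))"
    using S by (simp add: frechet_derivative_works)
  have Tp: "T (snd D p) = snd C p"
    using p by (simp add: T_def chart_inv_chart[OF manifold D])
  have "ddir (u \<circ> chart_inv D) w (snd D p) = ddir (u \<circ> chart_inv C) (ddir T w (snd D p)) (snd C p)"
    if u: "smooth_near M p u"
  proof (rule ddir_eqI[OF S])
    show "(u \<circ> chart_inv D) y = (u \<circ> chart_inv C) (T y)" if "y \<in> S" for y
      using that by (auto simp: S_def T_def chart_inv_chart[OF manifold D] chart_inv_chart[OF manifold C])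
    have "((u \<circ> chart_inv C) has_derivative frechet_derivative (u \<circ> chart_inv C) (at (snd C p)))
        (at (T (snd D p)))"
      using smooth_near_differentiable[OF manifold C u p(1)] by (simp add: Tp frechet_derivative_works)
    from has_derivative_compose[OF T this]
    show "((\<lambda>y. (u \<circ> chart_inv C) (T y)) has_derivative
        (\<lambda>w. ddir (u \<circ> chart_inv C) (ddir T w (snd D p)) (snd C p))) (at (snd D p))" .
  qed
  then show "coord_vec M D p w u = coord_vec M C p (ddir (snd C \<circ> chart_inv D) w (snd D p)) u"
    by (simp add: coord_vec_def T_def)
qed

end

lemma metric_on_metric_coeff:
  fixes M :: "('a, 'e::euclidean_space) mfd"
  assumes M: "semi_riemannian M g" and C: "C \<in> atlas M"
  shows "metric_on (chart_img C) (metric_coeff M g C)"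
  unfolding metric_on_def
proof (intro conjI ballI allI impI)
  have manifold: "smooth_manifold M" using M by (simp add: semi_riemannian_def)
  show "open (chart_img C)" using chart_img_open[OF manifold C] .
  show "Ck_on 2 (chart_img C) (\<lambda>x. metric_coeff M g C x v w)" for v w
    using M C by (simp add: semi_riemannian_def Cinf_on_def)
  fix x assume "x \<in> chart_img C"
  define p where "p = chart_inv C x"
  have p: "p \<in> chart_dom C"
    using \<open>x \<in> chart_img C\<close> unfolding p_def by (rule inv_into_into)
  then have pM: "p \<in> points M" using chart_dom_subset[OF manifold C] by auto
  note tan = coord_vec_in_tangent_space[OF manifold C p]
  have coeff: "metric_coeff M g C x v w = g p (coord_vec M C p v) (coord_vec M C p w)" for v w
    by (simp add: metric_coeff_def p_def)
  show sym: "metric_coeff M g C x v w = metric_coeff M g C x w v" for v w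
    using M pM tan unfolding coeff semi_riemannian_def by blast
  have lin: "metric_coeff M g C x (a *\<^sub>R v + b *\<^sub>R v') w
      = a * metric_coeff M g C x v w + b * metric_coeff M g C x v' w" for a b v v' w
    using M pM tan unfolding coeff coord_vec_linear[OF manifold C p] semi_riemannian_def by blast
  have "linear (\<lambda>v. metric_coeff M g C x v w)" for w
  proof (rule linearI)
    show "metric_coeff M g C x (v + v') w = metric_coeff M g C x v w + metric_coeff M g C x v' w" for v v'
      using lin[of 1 v 1 v' w] by simp
    show "metric_coeff M g C x (a *\<^sub>R v) w = a *\<^sub>R metric_coeff M g C x v w" for a v
      using lin[of a v 0 v w] by simp
  qed
  then show "bilinear (metric_coeff M g C x)"
    unfolding bilinear_def using sym by simp
  fix v assume v: "\<forall>w. metric_coeff M g C x v w = 0"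
  \<comment> \<open>Y may come from another chart D; rewritten as a vector of C it falls under the
    assumption on v.\<close>
  have "g p (coord_vec M C p v) Y = 0" if "Y \<in> tangent_space M p" for Y
  proof -
    obtain D w where D: "D \<in> atlas M" "p \<in> chart_dom D" "Y = coord_vec M D p w"
      using \<open>Y \<in> tangent_space M p\<close> by (auto simp: tangent_space_def)
    then show ?thesis
      using v coord_vec_change_chart[OF manifold C D(1) p D(2)] by (simp add: coeff)
  qed
  then have "coord_vec M C p v = (\<lambda>u. 0)"
    using M pM tan unfolding semi_riemannian_def by blast
  then show "v = 0" by (rule coord_vec_eq_zeroD[OF manifold C p])
qed

section \<open>Product charts\<close>

definition prod_chart :: "('a, 'e) chart \<Rightarrow> ('b, 'f) chart \<Rightarrow> ('a \<times> 'b, 'e \<times> 'f) chart" where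
  "prod_chart C D = (chart_dom C \<times> chart_dom D, map_prod (snd C) (snd D))"

lemma prod_chart_img: "chart_img (prod_chart C D) = chart_img C \<times> chart_img D"
  by (auto simp: prod_chart_def map_prod_surj_on)

lemma atlas_prod: "atlas (prod_mfd M N) = {prod_chart C D | C D. C \<in> atlas M \<and> D \<in> atlas N}"
  by (simp add: prod_mfd_def prod_chart_def)

context
  fixes M :: "('a, 'e::euclidean_space) mfd" and N :: "('b, 'f::euclidean_space) mfd" and C D
  assumes M: "smooth_manifold M" and C: "C \<in> atlas M"
    and N: "smooth_manifold N" and D: "D \<in> atlas N"
begin

lemma prod_chart_inv_image:
  assumes "p \<in> chart_dom C" "q \<in> chart_dom D"
  shows "chart_inv (prod_chart C D) (snd C p, snd D q) = (p, q)"
proof -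
  have "inj_on (snd (prod_chart C D)) (chart_dom (prod_chart C D))"
    using chart_inj[OF M C] chart_inj[OF N D] by (simp add: prod_chart_def map_prod_inj_on)
  moreover have "(p, q) \<in> chart_dom (prod_chart C D)"
    using assms by (simp add: prod_chart_def)
  ultimately have "chart_inv (prod_chart C D) (snd (prod_chart C D) (p, q)) = (p, q)"
    by (rule inv_into_f_f)
  then show ?thesis by (simp add: prod_chart_def)
qed

lemma prod_chart_inv:
  assumes "x \<in> chart_img C" "y \<in> chart_img D"
  shows "chart_inv (prod_chart C D) (x, y) = (chart_inv C x, chart_inv D y)"
  using prod_chart_inv_image[OF inv_into_into[OF assms(1)] inv_into_into[OF assms(2)]] assms
  by (simp add: f_inv_into_f)

text \<open>In coordinates the projection of the product is the linear map \<open>fst\<close>, so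
  \<open>Ck_on_compose_linear\<close> applies.\<close>

lemma prod_chart_smooth_fst:
  assumes "openin (mtop M) W" "Cinf_on (snd C ` (chart_dom C \<inter> W)) (u \<circ> chart_inv C)"
  shows "Cinf_on (snd (prod_chart C D) ` (chart_dom (prod_chart C D) \<inter> (W \<times> points N)))
     ((u \<circ> fst) \<circ> chart_inv (prod_chart C D))"
  unfolding Cinf_on_def
proof
  fix k
  define S where "S = snd C ` (chart_dom C \<inter> W)"
  have eq: "snd (prod_chart C D) ` (chart_dom (prod_chart C D) \<inter> (W \<times> points N)) = S \<times> chart_img D"
    using chart_dom_subset[OF N D] by (force simp: prod_chart_def S_def)
  have "open S" unfolding S_def by (rule open_chart_image[OF M C assms(1)])
  then have op: "open (S \<times> chart_img D)"
    using chart_img_open[OF N D] by (rule open_Times)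
  have "Ck_on k (S \<times> chart_img D) (\<lambda>z. (u \<circ> chart_inv C) (fst z))"
    using assms(2) \<open>open S\<close>
    by (intro Ck_on_compose_linear[OF bounded_linear_fst _ _ op, of S]) (auto simp: Cinf_on_def S_def comp_def)
  moreover have "((u \<circ> fst) \<circ> chart_inv (prod_chart C D)) z = (u \<circ> chart_inv C) (fst z)"
    if "z \<in> S \<times> chart_img D" for z
  proof -
    have "fst z \<in> chart_img C" "snd z \<in> chart_img D"
      using that by (auto simp: S_def)
    from prod_chart_inv[OF this] show ?thesis by simp
  qed
  ultimately show "Ck_on k (snd (prod_chart C D) ` (chart_dom (prod_chart C D) \<inter> (W \<times> points N)))
     ((u \<circ> fst) \<circ> chart_inv (prod_chart C D))"
    unfolding eq using Ck_on_cong[OF op, of "(u \<circ> fst) \<circ> chart_inv (prod_chart C D)"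
        "\<lambda>z. (u \<circ> chart_inv C) (fst z)"] by blast
qed

lemma prod_chart_smooth_snd:
  assumes "openin (mtop N) W" "Cinf_on (snd D ` (chart_dom D \<inter> W)) (u \<circ> chart_inv D)"
  shows "Cinf_on (snd (prod_chart C D) ` (chart_dom (prod_chart C D) \<inter> (points M \<times> W)))
     ((u \<circ> snd) \<circ> chart_inv (prod_chart C D))"
  unfolding Cinf_on_def
proof
  fix k
  define S where "S = snd D ` (chart_dom D \<inter> W)"
  have eq: "snd (prod_chart C D) ` (chart_dom (prod_chart C D) \<inter> (points M \<times> W)) = chart_img C \<times> S"
    using chart_dom_subset[OF M C] by (force simp: prod_chart_def S_def)
  have "open S" unfolding S_def by (rule open_chart_image[OF N D assms(1)])
  with chart_img_open[OF M C] have op: "open (chart_img C \<times> S)"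
    by (rule open_Times)
  have "Ck_on k (chart_img C \<times> S) (\<lambda>z. (u \<circ> chart_inv D) (snd z))"
    using assms(2) \<open>open S\<close>
    by (intro Ck_on_compose_linear[OF bounded_linear_snd _ _ op, of S]) (auto simp: Cinf_on_def S_def comp_def)
  moreover have "((u \<circ> snd) \<circ> chart_inv (prod_chart C D)) z = (u \<circ> chart_inv D) (snd z)"
    if "z \<in> chart_img C \<times> S" for z
  proof -
    have "fst z \<in> chart_img C" "snd z \<in> chart_img D"
      using that by (auto simp: S_def)
    from prod_chart_inv[OF this] show ?thesis by simp
  qed
  ultimately show "Ck_on k (snd (prod_chart C D) ` (chart_dom (prod_chart C D) \<inter> (points M \<times> W)))
     ((u \<circ> snd) \<circ> chart_inv (prod_chart C D))"
    unfolding eq using Ck_on_cong[OF op, of "(u \<circ> snd) \<circ> chart_inv (prod_chart C D)"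
        "\<lambda>z. (u \<circ> chart_inv D) (snd z)"] by blast
qed

end

section \<open>Projections and the warped metric in product charts\<close>

context
  fixes M :: "('a, 'e::euclidean_space) mfd" and N :: "('b, 'f::euclidean_space) mfd"
  assumes M: "smooth_manifold M" and N: "smooth_manifold N"
begin

text \<open>Ensures that a coordinate vector of the product evaluates \<open>u \<circ> fst\<close>
  by differentiation and not by its default value 0, so that the differential of the projection is
  the expected one.\<close>

lemma smooth_near_compose_fst:
  assumes "smooth_near M p u" "q \<in> points N"
  shows "smooth_near (prod_mfd M N) (p, q) (u \<circ> fst)"
proof -
  obtain W where W: "openin (mtop M) W" "p \<in> W" "smooth_fun_on M W u"
    using assms(1) by (auto simp: smooth_near_def)
  have "smooth_fun_on (prod_mfd M N) (W \<times> points N) (u \<circ> fst)"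
    unfolding smooth_fun_on_def
  proof
    fix P assume "P \<in> atlas (prod_mfd M N)"
    then obtain C D where P: "P = prod_chart C D" and CD: "C \<in> atlas M" "D \<in> atlas N"
      by (auto simp: atlas_prod)
    show "Cinf_on (snd P ` (chart_dom P \<inter> (W \<times> points N))) (u \<circ> fst \<circ> chart_inv P)"
      unfolding P using W(1,3) CD
      by (intro prod_chart_smooth_fst[OF M CD(1) N CD(2)]) (auto simp: smooth_fun_on_def)
  qed
  moreover have "openin (mtop (prod_mfd M N)) (W \<times> points N)"
    using W(1) by (simp add: prod_mfd_def openin_prod_Times_iff)
  ultimately show ?thesis
    using W(2) assms(2) by (auto simp: smooth_near_def)
qed

lemma smooth_near_compose_snd:
  assumes "smooth_near N q u" "p \<in> points M"
  shows "smooth_near (prod_mfd M N) (p, q) (u \<circ> snd)"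
proof -
  obtain W where W: "openin (mtop N) W" "q \<in> W" "smooth_fun_on N W u"
    using assms(1) by (auto simp: smooth_near_def)
  have "smooth_fun_on (prod_mfd M N) (points M \<times> W) (u \<circ> snd)"
    unfolding smooth_fun_on_def
  proof
    fix P assume "P \<in> atlas (prod_mfd M N)"
    then obtain C D where P: "P = prod_chart C D" and CD: "C \<in> atlas M" "D \<in> atlas N"
      by (auto simp: atlas_prod)
    show "Cinf_on (snd P ` (chart_dom P \<inter> (points M \<times> W))) (u \<circ> snd \<circ> chart_inv P)"
      unfolding P using W(1,3) CD
      by (intro prod_chart_smooth_snd[OF M CD(1) N CD(2)]) (auto simp: smooth_fun_on_def)
  qed
  moreover have "openin (mtop (prod_mfd M N)) (points M \<times> W)"
    using W(1) by (simp add: prod_mfd_def openin_prod_Times_iff)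
  ultimately show ?thesis
    using W(2) assms(2) by (auto simp: smooth_near_def)
qed

context
  fixes C D p q
  assumes C: "C \<in> atlas M" and D: "D \<in> atlas N" and p: "p \<in> chart_dom C" and q: "q \<in> chart_dom D"
begin

lemma differential_fst_coord_vec:
  "differential M fst (p, q) (coord_vec (prod_mfd M N) (prod_chart C D) (p, q) v) = coord_vec M C p (fst v)"
proof
  fix u
  have "ddir (u \<circ> fst \<circ> chart_inv (prod_chart C D)) v (snd C p, snd D q)
      = ddir (u \<circ> chart_inv C) (fst v) (snd C p)" if "smooth_near M p u"
  proof (rule ddir_eqI)
    show "open (chart_img C \<times> chart_img D)"
      using chart_img_open[OF M C] chart_img_open[OF N D] by (rule open_Times)
    show "(u \<circ> fst \<circ> chart_inv (prod_chart C D)) z = (u \<circ> chart_inv C) (fst z)"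
      if "z \<in> chart_img C \<times> chart_img D" for z
      using prod_chart_inv[OF M C N D, of "fst z" "snd z"] that by (simp add: mem_Times_iff)
    show "((\<lambda>z. (u \<circ> chart_inv C) (fst z)) has_derivative
        (\<lambda>v. ddir (u \<circ> chart_inv C) (fst v) (snd C p))) (at (snd C p, snd D q))"
      by (intro has_derivative_compose_fst smooth_near_differentiable[OF M C that p])
  qed (use p q in auto)
  then show "differential M fst (p, q) (coord_vec (prod_mfd M N) (prod_chart C D) (p, q) v) u
      = coord_vec M C p (fst v) u"
    using smooth_near_compose_fst[of p u q] q chart_dom_subset[OF N D]
    by (auto simp: differential_def coord_vec_def prod_chart_def)
qed

lemma differential_snd_coord_vec:
  "differential N snd (p, q) (coord_vec (prod_mfd M N) (prod_chart C D) (p, q) v) = coord_vec N D q (snd v)"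
proof
  fix u
  have "ddir (u \<circ> snd \<circ> chart_inv (prod_chart C D)) v (snd C p, snd D q)
      = ddir (u \<circ> chart_inv D) (snd v) (snd D q)" if "smooth_near N q u"
  proof (rule ddir_eqI)
    show "open (chart_img C \<times> chart_img D)"
      using chart_img_open[OF M C] chart_img_open[OF N D] by (rule open_Times)
    show "(u \<circ> snd \<circ> chart_inv (prod_chart C D)) z = (u \<circ> chart_inv D) (snd z)"
      if "z \<in> chart_img C \<times> chart_img D" for z
      using prod_chart_inv[OF M C N D, of "fst z" "snd z"] that by (simp add: mem_Times_iff)
    show "((\<lambda>z. (u \<circ> chart_inv D) (snd z)) has_derivative
        (\<lambda>v. ddir (u \<circ> chart_inv D) (snd v) (snd D q))) (at (snd C p, snd D q))"
      by (intro has_derivative_compose_snd smooth_near_differentiable[OF N D that q])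
  qed (use p q in auto)
  then show "differential N snd (p, q) (coord_vec (prod_mfd M N) (prod_chart C D) (p, q) v) u
      = coord_vec N D q (snd v) u"
    using smooth_near_compose_snd[of q u p] p chart_dom_subset[OF M C]
    by (auto simp: differential_def coord_vec_def prod_chart_def)
qed

end

text \<open>Supplies \<open>G_eq\<close> for the locale \<open>warped\<close>: the differentials of
  the projections split a coordinate vector of the product chart into its two components.\<close>

lemma metric_coeff_warped:
  assumes C: "C \<in> atlas M" and D: "D \<in> atlas N" and x: "x \<in> chart_img C" and y: "y \<in> chart_img D"
  shows "metric_coeff (prod_mfd M N) (warped_metric M g f N k) (prod_chart C D) (x, y) v w
    = metric_coeff M g C x (fst v) (fst w)
      + ((f \<circ> chart_inv C) x)\<^sup>2 * metric_coeff N k D y (snd v) (snd w)"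
  by (simp add: metric_coeff_def warped_metric_def prod_chart_inv[OF M C N D x y]
      differential_fst_coord_vec[OF C D inv_into_into[OF x] inv_into_into[OF y]]
      differential_snd_coord_vec[OF C D inv_into_into[OF x] inv_into_into[OF y]])

end

section \<open>From product charts to the whole manifold\<close>

lemma obtain_chart_ball:
  assumes M: "smooth_manifold M" and p: "p \<in> points M"
  obtains C X where "C \<in> atlas M" "p \<in> chart_dom C" "convex X" "open X" "X \<subseteq> chart_img C" "snd C p \<in> X"
proof -
  obtain C where C: "C \<in> atlas M" "p \<in> chart_dom C"
    using M p unfolding smooth_manifold_def by blast
  then obtain r where "r > 0" "ball (snd C p) r \<subseteq> chart_img C"
    using openE[OF chart_img_open[OF M C(1)]] by blast
  with C show ?thesis
    by (intro that[of C "ball (snd C p) r"]) auto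
qed

context
  fixes B :: "('b, 'n::euclidean_space) mfd" and gB
    and F :: "('f, 'm::euclidean_space) mfd" and gF
    and f :: "'b \<Rightarrow> real" and h :: "'b \<times> 'f \<Rightarrow> real" and \<rho> :: real
  assumes base: "semi_riemannian B gB" and fiber: "semi_riemannian F gF"
    and f: "smooth_fun_on B (points B) f" and f_pos: "\<forall>p\<in>points B. f p > 0"
    and soliton: "gradient_ricci_soliton (prod_mfd B F) (warped_metric B gB f F gF) h \<rho>"
begin

lemma base_manifold: "smooth_manifold B" and fiber_manifold: "smooth_manifold F"
  using base fiber by (auto simp: semi_riemannian_def)

context
  fixes C D
  assumes C: "C \<in> atlas B" and D: "D \<in> atlas F"
begin

lemma warped_charts:
  "warped (chart_img C) (metric_coeff B gB C) (chart_img D) (metric_coeff F gF D)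
     (f \<circ> chart_inv C)
     (metric_coeff (prod_mfd B F) (warped_metric B gB f F gF) (prod_chart C D))"
proof
  show "metric_on (chart_img C) (metric_coeff B gB C)"
    by (rule metric_on_metric_coeff[OF base C])
  show "metric_on (chart_img D) (metric_coeff F gF D)"
    by (rule metric_on_metric_coeff[OF fiber D])
  show "Ck_on 2 (chart_img C) (f \<circ> chart_inv C)"
    by (rule smooth_fun_on_Ck_chart[OF base_manifold C f])
  show "0 < (f \<circ> chart_inv C) x" if "x \<in> chart_img C" for x
    using f_pos inv_into_into[OF that] chart_dom_subset[OF base_manifold C] by auto
  show "metric_coeff (prod_mfd B F) (warped_metric B gB f F gF) (prod_chart C D) (x, y) v w
    = metric_coeff B gB C x (fst v) (fst w)
      + ((f \<circ> chart_inv C) x)\<^sup>2 * metric_coeff F gF D y (snd v) (snd w)"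
    if "x \<in> chart_img C" "y \<in> chart_img D" for x y v w
    by (rule metric_coeff_warped[OF base_manifold fiber_manifold C D that])
qed

interpretation warped "chart_img C" "metric_coeff B gB C" "chart_img D" "metric_coeff F gF D"
  "f \<circ> chart_inv C" "metric_coeff (prod_mfd B F) (warped_metric B gB f F gF) (prod_chart C D)"
  by (rule warped_charts)

lemma potential_C2: "Ck_on 2 (chart_img C \<times> chart_img D) (h \<circ> chart_inv (prod_chart C D))"
proof -
  have "smooth_manifold (prod_mfd B F)" "smooth_fun_on (prod_mfd B F) (points (prod_mfd B F)) h"
    using soliton by (auto simp: gradient_ricci_soliton_def semi_riemannian_def)
  moreover have "prod_chart C D \<in> atlas (prod_mfd B F)"
    unfolding atlas_prod using C D by blast
  ultimately show ?thesis
    unfolding prod_chart_img[symmetric] by (intro smooth_fun_on_Ck_chart)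
qed

lemma soliton_chart:
  assumes "x \<in> chart_img C" "y \<in> chart_img D"
  shows "ricci_of (metric_coeff (prod_mfd B F) (warped_metric B gB f F gF) (prod_chart C D)) (x, y) v w
      + (ddir (\<lambda>z. ddir (h \<circ> chart_inv (prod_chart C D)) w z) v (x, y)
         - ddir (h \<circ> chart_inv (prod_chart C D)) (levi_civita
             (metric_coeff (prod_mfd B F) (warped_metric B gB f F gF) (prod_chart C D)) (x, y) v w) (x, y))
    = \<rho> * metric_coeff (prod_mfd B F) (warped_metric B gB f F gF) (prod_chart C D) (x, y) v w"
proof -
  have "prod_chart C D \<in> atlas (prod_mfd B F)"
    unfolding atlas_prod using C D by blast
  moreover have "(x, y) \<in> chart_img (prod_chart C D)"
    using assms by (simp add: prod_chart_img)
  ultimately show ?thesis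
    using soliton unfolding gradient_ricci_soliton_def ricci_eq_ricci_of hessian_def
      christoffel_eq_levi_civita by blast
qed

text \<open>The ratio is now a function of points instead of coordinates, so its local constancy in
  p can be continued from one base chart to another.\<close>

lemma potential_ratio_chart:
  assumes "convex X" "open X" "X \<subseteq> chart_img C" "convex Y" "open Y" "Y \<subseteq> chart_img D"
    and "p \<in> chart_dom C" "snd C p \<in> X" "p' \<in> chart_dom C" "snd C p' \<in> X"
    and "q \<in> chart_dom D" "snd D q \<in> Y" "q' \<in> chart_dom D" "snd D q' \<in> Y"
  shows "(h (p, q) - h (p, q')) / f p = (h (p', q) - h (p', q')) / f p'"
  using potential_difference_proportional[OF potential_C2 potential_mixed_if_soliton[OF soliton_chart]
      assms(1-3,10,4-6,8,12,14)] assms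
  by (simp add: prod_chart_inv_image[OF base_manifold C fiber_manifold D]
      chart_inv_chart[OF base_manifold C])

lemma potential_eq_chart:
  assumes Y: "convex Y" "open Y" "Y \<subseteq> chart_img D"
    and p: "p \<in> chart_dom C" and hess: "hessian B gB f C (snd C p) v w \<noteq> 0"
    and q: "q \<in> chart_dom D" "snd D q \<in> Y" "q' \<in> chart_dom D" "snd D q' \<in> Y"
  shows "h (p, q) = h (p, q')"
proof -
  have "(h \<circ> chart_inv (prod_chart C D)) (snd C p, snd D q)
      = (h \<circ> chart_inv (prod_chart C D)) (snd C p, snd D q')"
    using hess p unfolding hessian_def christoffel_eq_levi_civita
    by (intro potential_eq_if_hessian_nonzero[OF potential_C2 soliton_chart _ Y q(2,4)]) auto
  then show ?thesis
    using p q by (simp add: prod_chart_inv_image[OF base_manifold C fiber_manifold D])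
qed

end

text \<open>The neighbourhood is a chart ball around q and serves all p at once. For q' in it, the
  ratio is locally constant on the connected base, and its vanishing at the single point p0 with
  nonzero Hessian spreads to every p.\<close>

lemma potential_locally_constant_on_fiber:
  assumes hess: "C0 \<in> atlas B" "x0 \<in> chart_img C0" "hessian B gB f C0 x0 v w \<noteq> 0"
    and q: "q \<in> points F"
  shows "\<exists>W. openin (mtop F) W \<and> q \<in> W \<and> (\<forall>q'\<in>W. \<forall>p\<in>points B. h (p, q') = h (p, q))"
proof -
  obtain D Y where D: "D \<in> atlas F" and qD: "q \<in> chart_dom D"
    and Y: "convex Y" "open Y" "Y \<subseteq> chart_img D" and qY: "snd D q \<in> Y"
    using obtain_chart_ball[OF fiber_manifold q] by metis
  obtain p0 where p0: "p0 \<in> chart_dom C0" "x0 = snd C0 p0"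
    using hess(2) by auto
  have p0B: "p0 \<in> points B"
    using p0(1) chart_dom_subset[OF base_manifold hess(1)] by blast
  have "h (p, q') = h (p, q)" if q': "q' \<in> chart_dom D" "snd D q' \<in> Y" and p: "p \<in> points B" for p q'
  proof -
    define R where "R = (\<lambda>p. (h (p, q') - h (p, q)) / f p)"
    have "\<exists>W. openin (mtop B) W \<and> p \<in> W \<and> (\<forall>p'\<in>W. R p' = R p)" if p: "p \<in> points B" for p
    proof -
      obtain C X where C: "C \<in> atlas B" and pC: "p \<in> chart_dom C"
        and X: "convex X" "open X" "X \<subseteq> chart_img C" and pX: "snd C p \<in> X"
        using obtain_chart_ball[OF base_manifold p] by metis
      have "R p' = R p" if "p' \<in> {p \<in> chart_dom C. snd C p \<in> X}" for p'
        unfolding R_def using that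
        by (intro potential_ratio_chart[OF C D X Y _ _ pC pX q' qD qY]) simp_all
      then show ?thesis
        using openin_chart_vimage[OF base_manifold C X(2)] pC pX
        by (intro exI[of _ "{p \<in> chart_dom C. snd C p \<in> X}"]) blast
    qed
    moreover have "connected_space (mtop B)"
      using base_manifold by (simp add: smooth_manifold_def)
    ultimately have "R p = R p0"
      using p p0B by (intro locally_constant_imp_constant[where X = "mtop B" and R = R])
    moreover have "h (p0, q') = h (p0, q)"
      using potential_eq_chart[OF hess(1) D Y p0(1) hess(3)[unfolded p0(2)] q' qD qY] .
    ultimately have "(h (p, q') - h (p, q)) / f p = 0"
      by (simp add: R_def)
    then show ?thesis
      using bspec[OF f_pos p] by simp
  qed
  then show ?thesis
    using openin_chart_vimage[OF fiber_manifold D Y(2)] qD qY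
    by (intro exI[of _ "{q \<in> chart_dom D. snd D q \<in> Y}"]) blast
qed

end

theorem theorem1p1:
  fixes B :: "('b, 'n::euclidean_space) mfd"
    and F :: "('f, 'm::euclidean_space) mfd"
    and f :: "'b \<Rightarrow> real" and h :: "'b \<times> 'f \<Rightarrow> real" and \<rho> :: real
  assumes "semi_riemannian B gB"
    and "semi_riemannian F gF"
    and "smooth_fun_on B (points B) f"
    and "\<forall>p\<in>points B. f p > 0"
    and "gradient_ricci_soliton (prod_mfd B F) (warped_metric B gB f F gF) h \<rho>"
    and "\<exists>C\<in>atlas B. \<exists>x\<in>chart_img C. \<exists>v w. hessian B gB f C x v w \<noteq> 0"
  shows "\<forall>p\<in>points B. \<forall>q\<in>points F. \<forall>q'\<in>points F. h (p, q) = h (p, q')"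
proof (intro ballI)
  fix p q q' assume p: "p \<in> points B" and q: "q \<in> points F" "q' \<in> points F"
  have "connected_space (mtop F)"
    using assms(2) by (simp add: semi_riemannian_def smooth_manifold_def)
  moreover have "\<exists>W. openin (mtop F) W \<and> y \<in> W \<and> (\<forall>y'\<in>W. h (p, y') = h (p, y))"
    if "y \<in> points F" for y
    using assms(6) potential_locally_constant_on_fiber[OF assms(1-5) _ _ _ that] p by meson
  ultimately show "h (p, q) = h (p, q')"
    using q by (rule locally_constant_imp_constant[where R = "\<lambda>q. h (p, q)"])
qed

end
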